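(* Let $X$ be a Hilbert space, $\omega$ a modulus of continuity, $C\subseteq X$ a subset, and $N:C\to S_X$ a mapping. The following are equivalent: (1) There exists a $C^{1,\omega}$ convex body $V$ such that $C\subseteq\partial V$ and $N(x)$ is the outer unit normal to $\partial V$ at $x$ for every $x\in C$. (2) There exists $\delta>0$ such that $$\langle N(y),y-x\rangle\ge \|N(x)-N(y)\|\,\omega^{-1}\big(\delta\|N(x)-N(y)\|\big)\quad\text{for all }x,y\in C.$$ Moreover, if $C$ is bounded, then $V$ can be taken to be bounded as well.
   Context: A convex body is a closed convex set with nonempty interior (possibly unbounded). A modulus of continuity is a concave, strictly increasing function $\omega:[0,\infty)\to[0,\infty)$ with $\omega(0)=0$ and $\lim_{t\to\infty}\omega(t)=\infty$; $\omega^{-1}$ is its inverse. A function $F:X\to\mathbb{R}$ is of class $C^{1,\omega}$ if it is differentiable and $\|\nabla F(x)-\nabla F(y)\|\le K\omega(\|x-y\|)$ for some $K>0$ and all $x,y$. A convex body $V$ is of class $C^{1,\omega}$ if $\partial V$ is a convex hypersurface of class $C^{1,\omega}$, i.e. there exist $M>0$ and a convex $F\in C^{1,\omega}(X)$ with $\partial V=F^{-1}(1)$ and $M^{-1}\le\|\nabla F(x)\|\le M$ for all $x\in\partial V$. *)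

theory Defs
  imports "HOL-Analysis.Analysis"
begin

definition modulus_of_continuity :: "(real \<Rightarrow> real) \<Rightarrow> bool" where
  "modulus_of_continuity \<omega> \<longleftrightarrow>
     concave_on {0..} \<omega> \<and> strict_mono_on {0..} \<omega> \<and> \<omega> 0 = 0 \<and>
     (\<forall>t\<ge>0. \<omega> t \<ge> 0) \<and> continuous_on {0..} \<omega> \<and> filterlim \<omega> at_top at_top"

definition modulus_inv :: "(real \<Rightarrow> real) \<Rightarrow> real \<Rightarrow> real" where
  "modulus_inv \<omega> = inv_into {0..} \<omega>"

definition is_gradient :: "('a::real_inner \<Rightarrow> real) \<Rightarrow> ('a \<Rightarrow> 'a) \<Rightarrow> bool" where
  "is_gradient F G \<longleftrightarrow> (\<forall>x. (F has_derivative (\<lambda>h. inner (G x) h)) (at x))"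

definition C1omega_fun_grad :: "(real \<Rightarrow> real) \<Rightarrow> ('a::real_inner \<Rightarrow> real) \<Rightarrow> ('a \<Rightarrow> 'a) \<Rightarrow> bool" where
  "C1omega_fun_grad \<omega> F G \<longleftrightarrow> is_gradient F G \<and>
     (\<exists>K>0. \<forall>x y. norm (G x - G y) \<le> K * \<omega> (norm (x - y)))"

definition convex_body :: "'a::real_normed_vector set \<Rightarrow> bool" where
  "convex_body V \<longleftrightarrow> closed V \<and> convex V \<and> interior V \<noteq> {}"

definition C1omega_convex_body :: "(real \<Rightarrow> real) \<Rightarrow> 'a::real_inner set \<Rightarrow> bool" where
  "C1omega_convex_body \<omega> V \<longleftrightarrow> convex_body V \<and>
     (\<exists>M>0. \<exists>F G. convex_on UNIV F \<and> C1omega_fun_grad \<omega> F G \<and>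
        frontier V = F -` {1} \<and>
        (\<forall>x\<in>frontier V. inverse M \<le> norm (G x) \<and> norm (G x) \<le> M))"

definition outer_unit_normal :: "'a::real_inner set \<Rightarrow> 'a \<Rightarrow> 'a \<Rightarrow> bool" where
  "outer_unit_normal V x n \<longleftrightarrow> x \<in> frontier V \<and> norm n = 1 \<and>
     (\<forall>y\<in>V. inner n (y - x) \<le> 0)"

end

theory Submission
  imports Defs
begin

text \<open>
  Given the condition on \<open>N\<close>, let \<open>\<psi>\<close> be a radial function of class \<open>C\<^sup>1\<^sup>,\<^sup>\<omega>\<close> whose radial derivative
  is proportional to \<open>\<omega>\<close>, frozen once it reaches slope 2, and let \<open>g\<close> be the infimum over \<open>y \<in> C\<close> of
  \<open>1 + \<langle>N y, z - y\<rangle> + \<psi> (z - y)\<close>. The condition implies that every affine function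
  \<open>1 + \<langle>N x, z - x\<rangle>\<close> with \<open>x \<in> C\<close> lies below \<open>g\<close>, hence below the convex envelope \<open>F\<close> of \<open>g\<close>.
  The envelope inherits the Lipschitz bound and the estimate
  \<open>g (x + h) + g (x - h) - 2 g x \<le> K \<parallel>h\<parallel> \<omega> \<parallel>h\<parallel>\<close>, which for a convex function amounts to being of
  class \<open>C\<^sup>1\<^sup>,\<^sup>\<omega>\<close>. The body is \<open>{F \<le> 1}\<close>, and it is bounded with \<open>C\<close> because \<open>\<psi>\<close> grows with slope 2
  while \<open>N\<close> has slope 1.

  Conversely, if \<open>F\<close> is convex with \<open>K \<omega>\<close>-continuous gradient, a step of length
  \<open>\<omega>\<^sup>-\<^sup>1 (\<parallel>\<nabla>F x - \<nabla>F y\<parallel> / 2K)\<close> from \<open>x\<close> against \<open>\<nabla>F x - \<nabla>F y\<close> improves the tangent inequality at \<open>y\<close>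
  to the required lower bound.
\<close>

section \<open>Moduli of continuity and their inverses\<close>

lemma modulus_mono:
  assumes "modulus_of_continuity \<omega>" "0 \<le> s" "s \<le> t"
  shows "\<omega> s \<le> \<omega> t"
  using assms unfolding modulus_of_continuity_def
  by (auto intro: strict_mono_on_leD)

lemma modulus_nonneg:
  assumes "modulus_of_continuity \<omega>" "0 \<le> t"
  shows "0 \<le> \<omega> t"
  using assms unfolding modulus_of_continuity_def by auto

text \<open>Concavity on a segment starting at 0, where \<open>\<omega>\<close> vanishes. Every
  later use of concavity goes through this inequality.\<close>

lemma modulus_scale:
  assumes "modulus_of_continuity \<omega>" "0 \<le> c" "c \<le> 1" "0 \<le> t"
  shows "c * \<omega> t \<le> \<omega> (c * t)"
proof -
  have "concave_on {0..} \<omega>" "\<omega> 0 = 0"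
    using assms(1) unfolding modulus_of_continuity_def by auto
  then show ?thesis
    using concave_onD[of "{0..}" \<omega> c 0 t] assms by simp
qed

lemma modulus_double:
  assumes "modulus_of_continuity \<omega>" "0 \<le> t"
  shows "\<omega> (2 * t) \<le> 2 * \<omega> t"
  using modulus_scale[OF assms(1), of "1/2" "2 * t"] assms(2) by simp

lemma modulus_tendsto_0:
  fixes \<omega> :: "real \<Rightarrow> real"
  assumes "modulus_of_continuity \<omega>"
    and "(f \<longlongrightarrow> 0) A" and "\<forall>\<^sub>F x in A. 0 \<le> f x"
  shows "((\<lambda>x. \<omega> (f x)) \<longlongrightarrow> 0) A"
proof -
  have "continuous_on {0..} \<omega>" "\<omega> 0 = 0"
    using assms(1) unfolding modulus_of_continuity_def by auto
  then have "((\<lambda>x. \<omega> (f x)) \<longlongrightarrow> \<omega> 0) A"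
    using continuous_on_tendsto_compose[of "{0..}" \<omega> f 0 A] assms(2,3) by simp
  then show ?thesis using \<open>\<omega> 0 = 0\<close> by simp
qed

text \<open>Continuity and divergence at infinity make \<open>\<omega>\<close> surjective onto the
  nonnegative reals by the intermediate value theorem, so \<open>inv_into\<close> returns genuine
  preimages.\<close>

lemma modulus_inv_works:
  assumes m: "modulus_of_continuity \<omega>" and t: "0 \<le> t"
  shows "0 \<le> modulus_inv \<omega> t" and "\<omega> (modulus_inv \<omega> t) = t"
proof -
  have lim: "filterlim \<omega> at_top at_top" and c: "continuous_on {0..} \<omega>" and z: "\<omega> 0 = 0"
    using m unfolding modulus_of_continuity_def by auto
  have "\<forall>\<^sub>F u in at_top. t \<le> \<omega> u"
    using lim by (simp add: filterlim_at_top)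
  then obtain b where b: "\<And>u. u \<ge> b \<Longrightarrow> t \<le> \<omega> u"
    by (auto simp: eventually_at_top_linorder)
  have "continuous_on {0..max b 0} \<omega>"
    using c by (rule continuous_on_subset) auto
  then obtain s where "0 \<le> s" "\<omega> s = t"
    using IVT'[of \<omega> 0 t "max b 0"] b[of "max b 0"] z t by auto
  then have "t \<in> \<omega> ` {0..}" by auto
  then show "0 \<le> modulus_inv \<omega> t" "\<omega> (modulus_inv \<omega> t) = t"
    using inv_into_into[of t \<omega> "{0..}"] f_inv_into_f[of t \<omega> "{0..}"]
    by (auto simp: modulus_inv_def)
qed

lemma modulus_le_cancel:
  assumes "modulus_of_continuity \<omega>" "0 \<le> s" "0 \<le> t" "\<omega> s \<le> \<omega> t"
  shows "s \<le> t"
proof -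
  have "strict_mono_on {0..} \<omega>" using assms(1) unfolding modulus_of_continuity_def by blast
  then show ?thesis using strict_mono_on_less_eq[of "{0..}" \<omega> s t] assms by simp
qed

lemma modulus_inv_mono:
  assumes "modulus_of_continuity \<omega>" "0 \<le> s" "s \<le> t"
  shows "modulus_inv \<omega> s \<le> modulus_inv \<omega> t"
  by (rule modulus_le_cancel[OF assms(1)]) (use assms modulus_inv_works[OF assms(1)] in auto)

text \<open>The inverse of a concave modulus is convex and vanishes at 0. This moves a constant
  factor from in front of the inverse into its argument, and so into
  \<open>\<delta>\<close>.\<close>

lemma modulus_inv_scale:
  assumes "modulus_of_continuity \<omega>" "0 \<le> c" "c \<le> 1" "0 \<le> t"
  shows "modulus_inv \<omega> (c * t) \<le> c * modulus_inv \<omega> t"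
proof (rule modulus_le_cancel[OF assms(1)])
  show "\<omega> (modulus_inv \<omega> (c * t)) \<le> \<omega> (c * modulus_inv \<omega> t)"
    using assms modulus_scale[OF assms(1-3), of "modulus_inv \<omega> t"]
    by (simp add: modulus_inv_works[OF assms(1)])
qed (use assms in \<open>auto intro!: mult_nonneg_nonneg modulus_inv_works[OF assms(1)]\<close>)

section \<open>Gradients of convex functions and the normals of a given body\<close>

lemma has_derivative_inner_line:
  fixes F :: "'a::real_inner \<Rightarrow> real"
  assumes "(F has_derivative (\<lambda>h. inner g h)) (at x)"
  shows "((\<lambda>t. F (x + t *\<^sub>R h)) has_real_derivative inner g h) (at 0)"
proof -
  have "((\<lambda>t. x + t *\<^sub>R h) has_derivative (\<lambda>t. t *\<^sub>R h)) (at 0)"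
    by (auto intro!: derivative_eq_intros)
  then have "((\<lambda>t. F (x + t *\<^sub>R h)) has_derivative (\<lambda>t. inner g (t *\<^sub>R h))) (at 0)"
    using has_derivative_compose[of "\<lambda>t. x + t *\<^sub>R h" "\<lambda>t. t *\<^sub>R h" 0 UNIV F "\<lambda>h. inner g h"] assms by simp
  then show ?thesis
    by (simp add: has_field_derivative_def mult_commute_abs)
qed

lemma convex_gradient_inequality:
  fixes F :: "'a::real_inner \<Rightarrow> real"
  assumes cv: "convex_on UNIV F" and d: "(F has_derivative (\<lambda>h. inner g h)) (at x)"
  shows "F x + inner g (z - x) \<le> F z"
proof (rule ccontr)
  assume "\<not> ?thesis"
  then have pos: "inner g (z - x) - (F z - F x) > 0" by simp
  \<comment> \<open>If the tangent rose faster than the chord from \<open>x\<close> to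
    \<open>z\<close>, then \<open>F\<close> minus that chord would have positive derivative at 0,
    and \<open>F\<close> would exceed the chord just after \<open>x\<close>.\<close>
  have "((\<lambda>t. F (x + t *\<^sub>R (z - x)) - t * (F z - F x))
      has_real_derivative (inner g (z - x) - (F z - F x))) (at 0)"
    by (auto intro!: derivative_eq_intros has_derivative_inner_line[OF d])
  then obtain e where e: "e > 0" "\<And>h. h > 0 \<Longrightarrow> h < e \<Longrightarrow>
      F x < F (x + h *\<^sub>R (z - x)) - h * (F z - F x)"
    using DERIV_pos_inc_right[OF _ pos] by force
  define t where "t = min (e / 2) 1"
  have t: "0 < t" "t < e" "t \<le> 1" using e(1) by (auto simp: t_def)
  have "x + t *\<^sub>R (z - x) = (1 - t) *\<^sub>R x + t *\<^sub>R z" by (simp add: algebra_simps)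
  then have "F (x + t *\<^sub>R (z - x)) \<le> (1 - t) * F x + t * F z"
    using convex_onD[OF cv, of t x z] t by simp
  with e(2)[OF t(1,2)] show False by (simp add: algebra_simps)
qed

text \<open>Of two half spaces bounded by hyperplanes through the origin, one can lie inside the
  other only if their normals agree. This serves to identify outer normals with normalised
  gradients, up to sign.\<close>

lemma unit_vector_eqI:
  fixes n g :: "'a::real_inner"
  assumes n: "norm n = 1" and g: "g \<noteq> 0"
    and le: "\<And>h. inner g h < 0 \<Longrightarrow> inner n h \<le> 0"
  shows "n = g /\<^sub>R norm g"
proof -
  define e where "e = g /\<^sub>R norm g"
  have ne: "norm e = 1" and ge: "g = norm g *\<^sub>R e" using g by (auto simp: e_def)
  have ee: "inner e e = 1" and nn: "inner n n = 1"
    using ne n by (simp_all add: dot_square_norm)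
  define a where "a = inner e n"
  have a1: "\<bar>a\<bar> \<le> 1" using Cauchy_Schwarz_ineq2[of e n] ne n by (simp add: a_def)
  have "a \<ge> 1"
  proof (rule ccontr)
    assume "\<not> a \<ge> 1"
    \<comment> \<open>With \<open>c\<close> strictly between \<open>a\<close> and 1,
      \<open>n - c *\<^sub>R e\<close> has negative product with \<open>g\<close> but positive
      product \<open>1 - c * a\<close> with \<open>n\<close>.\<close>
    define c where "c = (a + 1) / 2"
    have c: "a < c" "0 \<le> c" "c \<le> 1" using a1 \<open>\<not> a \<ge> 1\<close> by (auto simp: c_def)
    have "inner g (n - c *\<^sub>R e) = norm g * (a - c)"
      by (subst ge) (simp add: inner_diff_right ee a_def right_diff_distrib)
    then have "inner g (n - c *\<^sub>R e) < 0"
      using c g by (simp add: mult_pos_neg)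
    then have "1 \<le> c * a"
      using le[of "n - c *\<^sub>R e"] by (simp add: inner_diff_right nn a_def inner_commute)
    moreover have "c * a < 1"
    proof (cases "a \<ge> 0")
      case True
      then have "c * a \<le> 1 * a" using c by (intro mult_right_mono) auto
      then show ?thesis using \<open>\<not> a \<ge> 1\<close> by simp
    next
      case False
      then have "c * a \<le> 0" using c by (simp add: mult_nonneg_nonpos)
      then show ?thesis by simp
    qed
    ultimately show False by simp
  qed
  have "(norm (n - e))\<^sup>2 = 2 - 2 * a"
    by (simp add: power2_norm_eq_inner inner_diff_left inner_diff_right ee nn a_def inner_commute)
  with \<open>a \<ge> 1\<close> have "(norm (n - e))\<^sup>2 \<le> 0" by simp
  then show ?thesis by (simp add: e_def)
qed

text \<open>At a point \<open>z\<close> near \<open>x\<close>, the tangent plane at \<open>y\<close>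
  bounds \<open>F z\<close> from below, while the modulus of the gradient bounds it from above by
  the tangent plane at \<open>x\<close> plus an error. Comparing the two bounds leaves the
  gap.\<close>

lemma C1omega_convex_gap:
  fixes F :: "'a::real_inner \<Rightarrow> real"
  assumes m: "modulus_of_continuity \<omega>" and cv: "convex_on UNIV F" and gr: "is_gradient F G"
    and K: "K > 0" "\<And>x y. norm (G x - G y) \<le> K * \<omega> (norm (x - y))"
  shows "norm (G x - G y) / 2 * modulus_inv \<omega> (norm (G x - G y) / (2 * K))
         \<le> F x - F y - inner (G y) (x - y)"
proof -
  have tangent: "F a + inner (G a) (b - a) \<le> F b" for a b
    using convex_gradient_inequality[OF cv] gr unfolding is_gradient_def by blast
  define g where "g = G x - G y"
  show ?thesis
  proof (cases "g = 0")
    case True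
    then show ?thesis using tangent[of y x] by (simp add: g_def)
  next
    case False
    \<comment> \<open>This length makes \<open>K * \<omega> s\<close> half of \<open>norm g\<close>,
      so the change of gradient between \<open>x\<close> and \<open>z\<close> uses up only half of
      the linear gain \<open>s * norm g\<close>.\<close>
    define s where "s = modulus_inv \<omega> (norm g / (2 * K))"
    have s: "0 \<le> s" "\<omega> s = norm g / (2 * K)"
      using modulus_inv_works[OF m, of "norm g / (2 * K)"] K by (auto simp: s_def)
    define e where "e = g /\<^sub>R norm g"
    have e: "norm e = 1" "inner g e = norm g"
      using False by (auto simp: e_def dot_square_norm power2_eq_square)
    define z where "z = x - s *\<^sub>R e"
    have nz: "norm (z - x) = s" using s e by (simp add: z_def)
    have "inner (G z - G x) (z - x) \<le> norm (G z - G x) * norm (z - x)"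
      by (rule norm_cauchy_schwarz)
    also have "\<dots> \<le> K * \<omega> s * s"
      using K(2)[of z x] s nz by (intro mult_mono) auto
    also have "\<dots> = norm g / 2 * s" using s K by simp
    finally have "inner (G z) (z - x) \<le> inner (G x) (z - x) + norm g / 2 * s"
      by (simp add: inner_diff_left)
    then have "F z \<le> F x + inner (G x) (z - x) + norm g / 2 * s"
      using tangent[of z x] by (simp add: inner_diff_right)
    moreover have "F y + inner (G y) (z - y) \<le> F z" by (rule tangent)
    moreover have "inner (G x) (z - x) - inner (G y) (z - y) = - inner (G y) (x - y) - s * norm g"
      using e(2) by (simp add: z_def g_def inner_diff_right inner_diff_left algebra_simps)
    ultimately show ?thesis unfolding g_def[symmetric] s_def[symmetric]
      by (simp add: algebra_simps)
  qed
qed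

text \<open>The difference splits into the change of the vector at fixed scale and the change of its
  length; each contributes at most \<open>norm (a - b) / norm a\<close>.\<close>

lemma norm_sgn_diff_le:
  fixes a b :: "'a::real_inner"
  assumes "a \<noteq> 0" "b \<noteq> 0"
  shows "norm (a /\<^sub>R norm a - b /\<^sub>R norm b) \<le> 2 * norm (a - b) / norm a"
proof -
  have "a /\<^sub>R norm a - b /\<^sub>R norm b
      = (a - b) /\<^sub>R norm a + ((norm b - norm a) / norm a) *\<^sub>R (b /\<^sub>R norm b)"
  proof -
    have "(norm b - norm a) / norm a * inverse (norm b) = inverse (norm a) - inverse (norm b)"
      using assms by (simp add: field_simps)
    then show ?thesis by (simp add: scaleR_diff_left scaleR_diff_right)
  qed
  also have "norm \<dots> \<le> norm ((a - b) /\<^sub>R norm a) + norm (((norm b - norm a) / norm a) *\<^sub>R (b /\<^sub>R norm b))"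
    by (rule norm_triangle_ineq)
  also have "\<dots> = norm (a - b) / norm a + \<bar>norm b - norm a\<bar> / norm a"
    using assms by (simp add: abs_mult divide_inverse)
  also have "\<dots> \<le> norm (a - b) / norm a + norm (a - b) / norm a"
    using norm_triangle_ineq3[of b a] by (intro add_left_mono divide_right_mono) (auto simp: norm_minus_commute)
  finally show ?thesis by simp
qed

text \<open>The equation for \<open>frontier V\<close> does not say on which side of the level set
  \<open>V\<close> lies. If \<open>V\<close> meets \<open>{F < 1}\<close>, its normals on
  \<open>C\<close> are normalised gradients and \<open>C1omega_convex_gap\<close> applies; otherwise
  \<open>N\<close> is constant on \<open>C\<close>.\<close>

lemma normals_of_body_imp_condition:
  fixes C :: "'a::real_inner set"
  assumes m: "modulus_of_continuity \<omega>" and V: "C1omega_convex_body \<omega> V"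
    and N: "\<And>x. x \<in> C \<Longrightarrow> outer_unit_normal V x (N x)"
  shows "\<exists>\<delta>>0. \<forall>x\<in>C. \<forall>y\<in>C.
           norm (N x - N y) * modulus_inv \<omega> (\<delta> * norm (N x - N y)) \<le> inner (N y) (y - x)"
proof -
  obtain M F G K where M: "M > 0" and cv: "convex_on UNIV F" and gr: "is_gradient F G"
    and K: "K > 0" "\<And>x y. norm (G x - G y) \<le> K * \<omega> (norm (x - y))"
    and fr: "frontier V = F -` {1}"
    and GM: "\<And>x. x \<in> frontier V \<Longrightarrow> inverse M \<le> norm (G x) \<and> norm (G x) \<le> M"
    using V unfolding C1omega_convex_body_def C1omega_fun_grad_def by blast
  have clV: "closed V" and cvV: "convex V" and inV: "interior V \<noteq> {}"
    using V unfolding C1omega_convex_body_def convex_body_def by auto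
  have d: "(F has_derivative (\<lambda>h. inner (G x) h)) (at x)" for x
    using gr unfolding is_gradient_def by blast
  have tangent: "F a + inner (G a) (b - a) \<le> F b" for a b
    using convex_gradient_inequality[OF cv d] .
  have frV: "frontier V \<subseteq> V" using clV by (rule frontier_subset_closed)
  have G0: "G x \<noteq> 0" if "F x = 1" for x
    using GM[of x] fr that M by (auto simp: not_le)
  have Nx: "F x = 1" "x \<in> V" "norm (N x) = 1" "\<And>y. y \<in> V \<Longrightarrow> inner (N x) (y - x) \<le> 0" if "x \<in> C" for x
    using N[OF that] frV fr unfolding outer_unit_normal_def by auto
  have dec: "\<exists>e>0. \<forall>t>0. t < e \<longrightarrow> F (x + t *\<^sub>R h) < F x" if "inner (G x) h < 0" for x h
    using DERIV_neg_dec_right[OF has_derivative_inner_line[OF d, of x h] that] by simp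
  have inc: "\<exists>e>0. \<forall>t>0. t < e \<longrightarrow> F x < F (x + t *\<^sub>R h)" if "0 < inner (G x) h" for x h
    using DERIV_pos_inc_right[OF has_derivative_inner_line[OF d, of x h] that] by simp
  have cross: "\<exists>w\<in>closed_segment p q. F w = 1" if "p \<in> V" "q \<notin> V" for p q
    using connected_Int_frontier[of "closed_segment p q" V] that fr by auto
  show ?thesis
  proof (cases "\<exists>p\<in>V. F p < 1")
    case True
    then obtain p where p: "p \<in> V" "F p < 1" by blast
    \<comment> \<open>By convexity the segment from \<open>p\<close> to \<open>q\<close> stays in
      \<open>{F < 1}\<close>, so it cannot cross the frontier.\<close>
    have sub: "q \<in> V" if "F q < 1" for q
    proof (rule ccontr)
      assume "q \<notin> V"
      then obtain w where "w \<in> closed_segment p q" "F w = 1" using cross p by blast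
      then obtain t where t: "0 \<le> t" "t \<le> 1" "w = (1 - t) *\<^sub>R p + t *\<^sub>R q"
        by (auto simp: in_segment)
      have "F w \<le> (1 - t) * F p + t * F q" using convex_onD[OF cv, of t p q] t by simp
      also have "\<dots> < 1"
        using p(2) that t convex_bound_lt[of "F p" 1 "F q" "1 - t" t] by simp
      finally show False using \<open>F w = 1\<close> by simp
    qed
    have NG: "N x = G x /\<^sub>R norm (G x)" if x: "x \<in> C" for x
    proof (rule unit_vector_eqI)
      show "norm (N x) = 1" "G x \<noteq> 0" using Nx[OF x] G0 by auto
      fix h assume "inner (G x) h < 0"
      then obtain e where e: "e > 0" "\<And>t. t > 0 \<Longrightarrow> t < e \<Longrightarrow> F (x + t *\<^sub>R h) < F x"
        using dec by blast
      have "x + (e/2) *\<^sub>R h \<in> V" using e(2)[of "e/2"] e(1) Nx(1)[OF x] sub by simp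
      then have "inner (N x) ((e/2) *\<^sub>R h) \<le> 0" using Nx(4)[OF x] by fastforce
      then show "inner (N x) h \<le> 0" using e(1) by (simp add: mult_le_0_iff)
    qed
    \<comment> \<open>The factor \<open>1 / (4 * M\<^sup>2)\<close> collects
      \<open>1 / (2 * M)\<close> from comparing normals with gradients, \<open>1 / 2\<close> from
      the gap and \<open>1 / M\<close> from normalising \<open>G y\<close>. The cap at 1 allows
      \<open>modulus_inv_scale\<close> to absorb it into \<open>\<delta>\<close>.\<close>
    define c where "c = min 1 (1 / (4 * M\<^sup>2))"
    have c: "0 < c" "c \<le> 1" "c \<le> 1 / (4 * M\<^sup>2)" using M by (auto simp: c_def)
    define \<delta> where "\<delta> = c / (4 * K * M)"
    have "norm (N x - N y) * modulus_inv \<omega> (\<delta> * norm (N x - N y)) \<le> inner (N y) (y - x)"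
      if x: "x \<in> C" and y: "y \<in> C" for x y
    proof -
      define k where "k = norm (N x - N y)"
      define g where "g = norm (G x - G y)"
      have fx: "x \<in> frontier V" "y \<in> frontier V" using Nx(1) x y fr by auto
      have Gy: "norm (G y) > 0" "norm (G y) \<le> M" and Gx: "inverse M \<le> norm (G x)"
        using GM[OF fx(1)] GM[OF fx(2)] G0[OF Nx(1)[OF y]] by auto
      have "k \<le> 2 * g / norm (G x)"
        unfolding k_def g_def NG[OF x] NG[OF y]
        using G0 Nx(1) x y by (intro norm_sgn_diff_le) auto
      also have "\<dots> \<le> 2 * g / inverse M"
        using Gx M G0[OF Nx(1)[OF x]] by (intro divide_left_mono) (auto simp: g_def)
      finally have kg: "k / (2 * M) \<le> g" using M by (simp add: field_simps)
      have k0: "0 \<le> k" by (simp add: k_def)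
      have "k * modulus_inv \<omega> (\<delta> * k) = k * modulus_inv \<omega> (c * (k / (4 * K * M)))"
        by (simp add: \<delta>_def)
      also have "\<dots> \<le> k * (c * modulus_inv \<omega> (k / (4 * K * M)))"
        using c k0 K M by (intro mult_left_mono modulus_inv_scale[OF m]) auto
      also have "\<dots> = c * (k * modulus_inv \<omega> (k / (4 * K * M)))" by simp
      also have "\<dots> \<le> 1 / (4 * M\<^sup>2) * (k * modulus_inv \<omega> (k / (4 * K * M)))"
        using c k0 K M modulus_inv_works(1)[OF m, of "k / (4 * K * M)"]
        by (intro mult_right_mono mult_nonneg_nonneg) auto
      also have "\<dots> = (k / (2 * M) / 2 * modulus_inv \<omega> (k / (2 * M) / (2 * K))) / M"
        by (simp add: power2_eq_square mult.commute mult.left_commute)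
      also have "\<dots> \<le> (g / 2 * modulus_inv \<omega> (g / (2 * K))) / M"
        using kg K M k0
        by (intro divide_right_mono mult_mono modulus_inv_mono[OF m] modulus_inv_works(1)[OF m])
          (auto simp: g_def)
      also have "\<dots> \<le> (F x - F y - inner (G y) (x - y)) / M"
        using C1omega_convex_gap[OF m cv gr K, of x y] M unfolding g_def
        by (intro divide_right_mono) auto
      also have "\<dots> = inner (G y) (y - x) / M"
        using Nx(1) x y by (simp add: inner_diff_right)
      also have "\<dots> \<le> inner (G y) (y - x) / norm (G y)"
        using Gy M tangent[of y x] Nx(1) x y
        by (intro divide_left_mono) (auto simp: inner_diff_right)
      also have "\<dots> = inner (N y) (y - x)" by (simp add: NG[OF y] divide_inverse mult.commute)
      finally show ?thesis by (simp add: k_def)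
    qed
    moreover have "\<delta> > 0" using c K M by (simp add: \<delta>_def)
    ultimately show ?thesis by blast
  next
    \<comment> \<open>Here \<open>V = {F \<ge> 1}\<close> is convex together with \<open>{F < 1}\<close>, so \<open>V\<close> is a half space.\<close>
    case False
    then have V1: "\<And>p. p \<in> V \<Longrightarrow> 1 \<le> F p" by (meson not_le)
    obtain z where z: "z \<in> interior V" using inV by blast
    \<comment> \<open>A segment from \<open>q\<close> outside \<open>V\<close> to the interior point
      \<open>z\<close> meets the level set at \<open>w\<close>. Tilting it to end at a nearby
      \<open>z'\<close> in \<open>V\<close> pushes \<open>w\<close> to \<open>w'\<close> with
      \<open>F w' < 1\<close>. Before \<open>w'\<close> the tilted segment passes a point
      \<open>v\<close> of the frontier, so \<open>w'\<close> lies between \<open>v\<close> and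
      \<open>z'\<close> and convexity puts it in \<open>V\<close>, against
      \<open>V1\<close>.\<close>
    have sub: "q \<in> V" if "1 \<le> F q" for q
    proof (rule ccontr)
      assume q: "q \<notin> V"
      have Fq: "F q > 1" using that q fr frV by (cases "F q = 1") auto
      have "z \<in> V" using z interior_subset by blast
      then obtain w where "w \<in> closed_segment z q" and Fw: "F w = 1" using cross q by blast
      then obtain t where t: "0 \<le> t" "t \<le> 1" "w = (1 - t) *\<^sub>R q + t *\<^sub>R z"
        unfolding closed_segment_commute[of z q] by (auto simp: in_segment)
      have t0: "t > 0" using t Fw Fq by (cases "t = 0") auto
      obtain e where e: "e > 0" "\<And>s. s > 0 \<Longrightarrow> s < e \<Longrightarrow> F (w + s *\<^sub>R (- G w)) < 1"
        using dec[of w "- G w"] Fw G0[OF Fw] by auto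
      obtain r where r: "r > 0" "cball z r \<subseteq> V"
        using z by (meson mem_interior_cball)
      \<comment> \<open>Since \<open>z\<close> has weight \<open>t\<close> in \<open>w\<close>,
        shifting \<open>w\<close> by \<open>s *\<^sub>R G w\<close> means shifting \<open>z\<close>
        by \<open>(s / t) *\<^sub>R G w\<close>, which must stay within radius
        \<open>r\<close>.\<close>
      define s where "s = min (e / 2) (r * t / norm (G w))"
      have s: "0 < s" "s < e" "s \<le> r * t / norm (G w)"
        using e(1) r(1) t0 G0[OF Fw] by (auto simp: s_def)
      define z' where "z' = z - (s / t) *\<^sub>R G w"
      have "dist z z' \<le> r"
        using s t0 G0[OF Fw] by (simp add: z'_def dist_norm field_simps)
      then have z'V: "z' \<in> V" using r by auto
      define w' where "w' = (1 - t) *\<^sub>R q + t *\<^sub>R z'"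
      have "w' = w + s *\<^sub>R (- G w)" using t t0 by (simp add: w'_def z'_def scaleR_diff_right)
      then have Fw': "F w' < 1" using e(2) s by simp
      then have "w' \<notin> V" using V1 by force
      have "continuous_on {0..t} (\<lambda>u. F ((1 - u) *\<^sub>R q + u *\<^sub>R z'))"
      proof -
        have "continuous_on UNIV F"
          by (intro continuous_at_imp_continuous_on ballI has_derivative_continuous[OF d])
        then show ?thesis
          by (rule continuous_on_compose2) (auto intro!: continuous_intros)
      qed
      then obtain u where u: "0 \<le> u" "u \<le> t" "F ((1 - u) *\<^sub>R q + u *\<^sub>R z') = 1"
        using IVT2'[of "\<lambda>u. F ((1 - u) *\<^sub>R q + u *\<^sub>R z')" t 1 0] Fq Fw' t0 by (auto simp: w'_def)
      define v where "v = (1 - u) *\<^sub>R q + u *\<^sub>R z'"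
      have "v \<in> V" using u fr frV by (auto simp: v_def)
      have "u < t" using u Fw' by (cases "u = t") (auto simp: w'_def)
      define l where "l = (1 - t) / (1 - u)"
      have l: "0 \<le> l" "l \<le> 1" "l * (1 - u) = 1 - t" using \<open>u < t\<close> t by (auto simp: l_def)
      have "l *\<^sub>R v + (1 - l) *\<^sub>R z' = (l * (1 - u)) *\<^sub>R q + (1 - l * (1 - u)) *\<^sub>R z'"
        by (simp add: v_def algebra_simps)
      then have "l *\<^sub>R v + (1 - l) *\<^sub>R z' = w'" by (simp add: l(3) w'_def)
      then have "w' \<in> V" using convexD[OF cvV \<open>v \<in> V\<close> z'V, of l "1 - l"] l by simp
      with \<open>w' \<notin> V\<close> show False by simp
    qed
    have NG: "N x = (- G x) /\<^sub>R norm (- G x)" if x: "x \<in> C" for x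
    proof (rule unit_vector_eqI)
      show "norm (N x) = 1" "- G x \<noteq> 0" using Nx[OF x] G0 by auto
      fix h assume "inner (- G x) h < 0"
      then obtain e where e: "e > 0" "\<And>t. t > 0 \<Longrightarrow> t < e \<Longrightarrow> F x < F (x + t *\<^sub>R h)"
        using inc[of x h] by auto
      have "x + (e/2) *\<^sub>R h \<in> V" using e(2)[of "e/2"] e(1) Nx(1)[OF x] sub by simp
      then have "inner (N x) ((e/2) *\<^sub>R h) \<le> 0" using Nx(4)[OF x] by fastforce
      then show "inner (N x) h \<le> 0" using e(1) by (simp add: mult_le_0_iff)
    qed
    have half: "F p < 1 \<longleftrightarrow> 0 < inner (N x) (p - x)" if x: "x \<in> C" for p x
    proof
      assume "F p < 1"
      then have "inner (G x) (p - x) < 0" using tangent[of x p] Nx(1)[OF x] by simp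
      then show "0 < inner (N x) (p - x)"
        using NG[OF x] G0[OF Nx(1)[OF x]] by (simp add: mult_pos_neg)
    next
      assume "0 < inner (N x) (p - x)"
      then show "F p < 1" using Nx(4)[OF x, of p] sub[of p] by linarith
    qed
    \<comment> \<open>By \<open>half\<close>, the same set \<open>{F < 1}\<close> is an open half
      space as seen from \<open>x\<close> and from \<open>y\<close>, so both normals agree.\<close>
    have Neq: "N x = N y" if x: "x \<in> C" and y: "y \<in> C" for x y
    proof -
      have "- N y = (- N x) /\<^sub>R norm (- N x)"
      proof (rule unit_vector_eqI)
        show "norm (- N y) = 1" "- N x \<noteq> 0" using Nx(3)[OF x] Nx(3)[OF y] by auto
        fix h assume "inner (- N x) h < 0"
        then have "0 < inner (N y) (x + h - y)" using half[OF x, of "x + h"] half[OF y, of "x + h"] by simp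
        moreover have "inner (N y) (x - y) \<le> 0" using Nx(4)[OF y] Nx(2)[OF x] by blast
        ultimately show "inner (- N y) h \<le> 0" by (simp add: inner_diff_right inner_add_right)
      qed
      then show ?thesis using Nx(3)[OF x] by simp
    qed
    \<comment> \<open>The left side vanishes for constant \<open>N\<close>, so any positive
      \<open>\<delta>\<close> would serve.\<close>
    have "norm (N x - N y) * modulus_inv \<omega> (1 * norm (N x - N y)) \<le> inner (N y) (y - x)"
      if x: "x \<in> C" and y: "y \<in> C" for x y
      using Neq[OF x y] Nx(4)[OF y Nx(2)[OF x]] by (simp add: inner_diff_right)
    then show ?thesis by (intro exI[of _ 1]) auto
  qed
qed

section \<open>Subgradients in a Hilbert space and smoothness from second differences\<close>

text \<open>\<open>p\<close> is the proximal point of \<open>x\<close>, the minimiser of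
  \<open>F\<close> plus a quadratic penalty. It exists because minimising sequences are Cauchy, and
  first order optimality makes \<open>(x - p) /\<^sub>R l\<close> a subgradient at
  \<open>p\<close>.\<close>

lemma prox_subgradient:
  fixes F :: "'a::{real_inner, complete_space} \<Rightarrow> real"
  assumes cv: "convex_on UNIV F" and lip: "\<And>x y. F x - F y \<le> L * norm (x - y)"
    and l: "l > 0"
  obtains p where "\<And>z. F p + inner ((x - p) /\<^sub>R l) (z - p) \<le> F z"
proof -
  define J where "J z = F z + (norm (z - x))\<^sup>2 / (2 * l)" for z
  have "F x - L\<^sup>2 * l / 2 \<le> J z" for z
  proof -
    define r where "r = norm (z - x)"
    have "0 \<le> (r - L * l)\<^sup>2 / (2 * l)" using l by simp
    also have "\<dots> = r\<^sup>2 / (2 * l) - L * r + L\<^sup>2 * l / 2"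
      using l by (simp add: power2_eq_square field_simps)
    finally show ?thesis
      using lip[of x z] by (simp add: J_def r_def norm_minus_commute)
  qed
  then have bdd: "bdd_below (range J)" by (auto intro!: bdd_belowI2)
  define \<mu> where "\<mu> = Inf (range J)"
  have \<mu>: "\<mu> \<le> J z" for z
    unfolding \<mu>_def using bdd by (rule cINF_lower) simp
  have "\<exists>z. J z < \<mu> + inverse (real (Suc n))" for n
    using cInf_lessD[of "range J" "\<mu> + inverse (real (Suc n))"] by (auto simp: \<mu>_def)
  then obtain z where z: "\<And>n. J (z n) < \<mu> + inverse (real (Suc n))" by metis
  \<comment> \<open>Strong convexity of \<open>J\<close>: by the parallelogram identity, testing the
    midpoint forces near-minimisers to be close to each other.\<close>
  have gap: "(norm (a - b))\<^sup>2 \<le> 4 * l * ((J a - \<mu>) + (J b - \<mu>))" for a b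
  proof -
    define c where "c = (1/2) *\<^sub>R a + (1/2) *\<^sub>R b"
    have "F c \<le> F a / 2 + F b / 2"
      using convex_onD[OF cv, of "1/2" a b] by (simp add: c_def)
    moreover have "(norm (c - x))\<^sup>2 = (norm (a - x))\<^sup>2 / 2 + (norm (b - x))\<^sup>2 / 2 - (norm (a - b))\<^sup>2 / 4"
      unfolding power2_norm_eq_inner c_def
      by (simp add: inner_diff_left inner_diff_right inner_add_left inner_add_right inner_commute
          field_simps)
    then have "(norm (c - x))\<^sup>2 / (2 * l)
        = (norm (a - x))\<^sup>2 / (2 * l) / 2 + (norm (b - x))\<^sup>2 / (2 * l) / 2 - (norm (a - b))\<^sup>2 / (8 * l)"
      by (simp add: diff_divide_distrib add_divide_distrib)
    ultimately have "J c \<le> J a / 2 + J b / 2 - (norm (a - b))\<^sup>2 / (8 * l)"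
      by (simp add: J_def add_divide_distrib)
    with \<mu>[of c] have "(norm (a - b))\<^sup>2 / (8 * l) \<le> J a / 2 + J b / 2 - \<mu>" by simp
    then show ?thesis using l by (simp add: field_simps)
  qed
  have "Cauchy z"
  proof (rule CauchyI)
    fix e :: real assume e: "e > 0"
    obtain k where k: "inverse (real (Suc k)) < e\<^sup>2 / (8 * l)"
      using reals_Archimedean[of "e\<^sup>2 / (8 * l)"] e l by auto
    have "norm (z m - z n) < e" if "k \<le> m" "k \<le> n" for m n
    proof -
      have "inverse (real (Suc m)) \<le> inverse (real (Suc k))"
        "inverse (real (Suc n)) \<le> inverse (real (Suc k))"
        using that by (auto intro!: le_imp_inverse_le)
      then have "(J (z m) - \<mu>) + (J (z n) - \<mu>) < 2 * (e\<^sup>2 / (8 * l))"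
        using z[of m] z[of n] k by linarith
      then have "4 * l * ((J (z m) - \<mu>) + (J (z n) - \<mu>)) < 4 * l * (2 * (e\<^sup>2 / (8 * l)))"
        using l by (intro mult_strict_left_mono) auto
      also have "\<dots> = e\<^sup>2" using l by simp
      finally have "(norm (z m - z n))\<^sup>2 < e\<^sup>2" using gap[of "z m" "z n"] by simp
      then show ?thesis using e by (simp add: power_less_imp_less_base)
    qed
    then show "\<exists>k. \<forall>m\<ge>k. \<forall>n\<ge>k. norm (z m - z n) < e" by blast
  qed
  then obtain p where p: "z \<longlonglongrightarrow> p" by (auto simp: Cauchy_convergent_iff convergent_def)
  have Jmin: "J p \<le> \<mu>"
  proof -
    have "F p + (norm (z n - x))\<^sup>2 / (2 * l) - L * norm (p - z n) \<le> \<mu> + inverse (real (Suc n))" for n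
      using z[of n] lip[of p "z n"] by (simp add: J_def)
    moreover have "(\<lambda>n. F p + (norm (z n - x))\<^sup>2 / (2 * l) - L * norm (p - z n))
        \<longlonglongrightarrow> F p + (norm (p - x))\<^sup>2 / (2 * l) - L * norm (p - p)"
      by (intro tendsto_intros p) (use l in auto)
    moreover have "(\<lambda>n. \<mu> + inverse (real (Suc n))) \<longlonglongrightarrow> \<mu> + 0"
      by (intro tendsto_intros LIMSEQ_inverse_real_of_nat)
    ultimately have "F p + (norm (p - x))\<^sup>2 / (2 * l) - L * norm (p - p) \<le> \<mu> + 0"
      by (intro LIMSEQ_le) auto
    then show ?thesis by (simp add: J_def)
  qed
  have "F p + inner ((x - p) /\<^sub>R l) (z - p) \<le> F z" for z
  proof (rule ccontr)
    assume neg: "\<not> ?thesis"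
    define A where "A = F z - F p - inner (x - p) (z - p) / l"
    define B where "B = (norm (z - p))\<^sup>2 / (2 * l)"
    have A: "A < 0" using neg by (simp add: A_def divide_inverse mult.commute)
    have B: "0 \<le> B" using l by (simp add: B_def)
    \<comment> \<open>Moving from \<open>p\<close> by the fraction \<open>t\<close> towards
      \<open>z\<close> changes \<open>J\<close> by at most \<open>t * A + t\<^sup>2 * B\<close>;
      this \<open>t\<close> keeps \<open>t * B\<close> below \<open>- A / 2\<close>, so the change
      is negative. The summand 1 keeps the denominator positive.\<close>
    define t where "t = min 1 (- A / (2 * (B + 1)))"
    have t: "0 < t" "t \<le> 1" "t \<le> - A / (2 * (B + 1))" using A B by (auto simp: t_def intro!: divide_pos_pos simp del: divide_minus_left)
    define q where "q = (1 - t) *\<^sub>R p + t *\<^sub>R z"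
    have Fq: "F q \<le> (1 - t) * F p + t * F z"
      using convex_onD[OF cv, of t p z] t by (simp add: q_def)
    have "(norm (q - x))\<^sup>2 = (norm (p - x))\<^sup>2 - 2 * t * inner (x - p) (z - p) + t\<^sup>2 * (norm (z - p))\<^sup>2"
      unfolding power2_norm_eq_inner q_def
      by (simp add: inner_diff_left inner_diff_right inner_add_left inner_add_right inner_commute
          algebra_simps power2_eq_square)
    then have "(norm (q - x))\<^sup>2 / (2 * l) = (norm (p - x))\<^sup>2 / (2 * l) - t * (inner (x - p) (z - p) / l) + t\<^sup>2 * B"
      using l by (simp add: B_def field_simps)
    then have "J q \<le> J p + t * A + t\<^sup>2 * B"
      using Fq by (simp add: J_def A_def algebra_simps)
    with \<mu>[of q] Jmin have "0 \<le> t * (A + t * B)" by (simp add: algebra_simps power2_eq_square)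
    then have "0 \<le> A + t * B" using t by (simp add: zero_le_mult_iff)
    moreover have "t * B \<le> - A / 2"
    proof -
      have "t * B \<le> - A / (2 * (B + 1)) * (B + 1)" using t B A by (intro mult_mono) auto
      also have "\<dots> = - A / 2" using B by (simp add: field_simps)
      finally show ?thesis .
    qed
    ultimately show False using A by simp
  qed
  then show thesis by (rule that)
qed

lemma subgradient_norm_le:
  fixes F :: "'a::real_inner \<Rightarrow> real"
  assumes "\<And>z. F p + inner \<xi> (z - p) \<le> F z" and "\<And>x y. F x - F y \<le> L * norm (x - y)" and "0 \<le> L"
  shows "norm \<xi> \<le> L"
proof (cases "\<xi> = 0")
  case False
  have "norm \<xi> * norm \<xi> \<le> L * norm \<xi>"
    using assms(1)[of "p + \<xi>"] assms(2)[of "p + \<xi>" p]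
    by (simp add: dot_square_norm power2_eq_square)
  then show ?thesis using False by simp
qed (use assms in simp)

text \<open>The subgradient inequality at the reflected point \<open>p - (z - p)\<close> turns the
  second difference bound into an upper bound at \<open>z\<close>.\<close>

lemma subgradient_upper_bound:
  fixes F :: "'a::real_inner \<Rightarrow> real"
  assumes "\<And>z. F p + inner \<xi> (z - p) \<le> F z"
    and "\<And>x h. F (x + h) + F (x - h) - 2 * F x \<le> \<sigma> h"
  shows "F z \<le> F p + inner \<xi> (z - p) + \<sigma> (z - p)"
  using assms(1)[of "p - (z - p)"] assms(2)[of p "z - p"] by (simp add: inner_diff_right)

text \<open>At \<open>y + h\<close>, with \<open>h\<close> of length \<open>s\<close> along
  \<open>\<zeta> - \<xi>\<close>, the lower bound from \<open>y\<close> meets the upper bound from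
  \<open>x\<close>. As \<open>y + h\<close> is within \<open>2 * s\<close> of \<open>x\<close>, the
  length and \<open>\<omega>\<close> each contribute a factor 2. The scale \<open>s\<close> is
  separate from \<open>norm (x - y)\<close> because \<open>ex_subgradient\<close> only bounds the
  distance.\<close>

lemma subgradient_modulus:
  fixes F :: "'a::real_inner \<Rightarrow> real"
  assumes m: "modulus_of_continuity \<omega>" and K: "0 \<le> K"
    and semi: "\<And>x h. F (x + h) + F (x - h) - 2 * F x \<le> K * norm h * \<omega> (norm h)"
    and \<xi>: "\<And>z. F x + inner \<xi> (z - x) \<le> F z"
    and \<zeta>: "\<And>z. F y + inner \<zeta> (z - y) \<le> F z"
    and s: "0 < s" "norm (x - y) \<le> s"
  shows "norm (\<xi> - \<zeta>) \<le> 4 * K * \<omega> s"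
proof (cases "\<zeta> = \<xi>")
  case True
  then show ?thesis using K modulus_nonneg[OF m, of s] s by simp
next
  case False
  define h where "h = (s / norm (\<zeta> - \<xi>)) *\<^sub>R (\<zeta> - \<xi>)"
  have h: "norm h = s" "inner (\<zeta> - \<xi>) h = s * norm (\<zeta> - \<xi>)"
    using False s by (auto simp: h_def dot_square_norm power2_eq_square)
  have n: "norm (y + h - x) \<le> 2 * s"
    using norm_triangle_ineq[of "y - x" h] h s by (simp add: norm_minus_commute algebra_simps)
  have "F y + inner \<zeta> h \<le> F (y + h)" using \<zeta>[of "y + h"] by simp
  also have "\<dots> \<le> F x + inner \<xi> (y + h - x) + K * norm (y + h - x) * \<omega> (norm (y + h - x))"
    using subgradient_upper_bound[OF \<xi> semi] .
  also have "K * norm (y + h - x) * \<omega> (norm (y + h - x)) \<le> K * (2 * s) * (2 * \<omega> s)"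
    using n s K modulus_mono[OF m _ n] modulus_double[OF m, of s] modulus_nonneg[OF m]
    by (intro mult_mono) auto
  finally have "inner (\<zeta> - \<xi>) h \<le> (F x + inner \<xi> (y - x) - F y) + K * (2 * s) * (2 * \<omega> s)"
    by (simp add: inner_diff_left inner_diff_right inner_add_right)
  then have "s * norm (\<zeta> - \<xi>) \<le> s * (4 * K * \<omega> s)"
    using \<xi>[of y] h by (simp add: algebra_simps)
  then show ?thesis using s by (simp add: norm_minus_commute)
qed

text \<open>Proximal points with parameter \<open>l n\<close> lie within \<open>L * l n\<close> of
  \<open>x\<close>, so by \<open>subgradient_modulus\<close> their subgradients form a Cauchy
  sequence. Its limit is a subgradient at \<open>x\<close> itself.\<close>

lemma ex_subgradient:
  fixes F :: "'a::{real_inner, complete_space} \<Rightarrow> real"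
  assumes m: "modulus_of_continuity \<omega>" and K: "0 \<le> K"
    and cv: "convex_on UNIV F" and lip: "\<And>x y. F x - F y \<le> L * norm (x - y)" and L: "0 < L"
    and semi: "\<And>x h. F (x + h) + F (x - h) - 2 * F x \<le> K * norm h * \<omega> (norm h)"
  shows "\<exists>\<xi>. \<forall>z. F x + inner \<xi> (z - x) \<le> F z"
proof -
  define l where "l n = inverse (real (Suc n))" for n
  have l: "l n > 0" for n by (simp add: l_def)
  have ll: "l \<longlonglongrightarrow> 0" unfolding l_def by (rule LIMSEQ_inverse_real_of_nat)
  have "\<forall>n. \<exists>p. \<forall>z. F p + inner ((x - p) /\<^sub>R l n) (z - p) \<le> F z"
    using prox_subgradient[OF cv lip l] by metis
  then obtain p where p: "\<And>n z. F (p n) + inner ((x - p n) /\<^sub>R l n) (z - p n) \<le> F z"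
    by metis
  define \<xi> where "\<xi> n = (x - p n) /\<^sub>R l n" for n
  have sub: "F (p n) + inner (\<xi> n) (z - p n) \<le> F z" for n z using p by (simp add: \<xi>_def)
  have n\<xi>: "norm (\<xi> n) \<le> L" for n using subgradient_norm_le[OF sub lip] L by simp
  have px: "norm (x - p n) \<le> L * l n" for n
  proof -
    have "norm (\<xi> n) = norm (x - p n) / l n" using l[of n] by (simp add: \<xi>_def divide_inverse)
    then show ?thesis using n\<xi>[of n] l[of n] by (simp add: pos_divide_le_eq)
  qed
  have "Cauchy \<xi>"
  proof (rule CauchyI)
    fix e :: real assume e: "e > 0"
    have "(\<lambda>n. 2 * L * l n) \<longlonglongrightarrow> 2 * L * 0" by (intro tendsto_intros ll)
    then have "(\<lambda>n. \<omega> (2 * L * l n)) \<longlonglongrightarrow> 0"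
      using L l by (intro modulus_tendsto_0[OF m]) (auto simp: less_imp_le)
    then have "(\<lambda>n. 4 * K * \<omega> (2 * L * l n)) \<longlonglongrightarrow> 4 * K * 0" by (intro tendsto_intros)
    then have "\<forall>\<^sub>F n in sequentially. 4 * K * \<omega> (2 * L * l n) < e"
      using e by (intro order_tendstoD) auto
    then obtain k where k: "4 * K * \<omega> (2 * L * l k) < e"
      by (auto simp: eventually_sequentially)
    have "norm (\<xi> i - \<xi> j) < e" if "k \<le> i" "k \<le> j" for i j
    proof -
      have "l i \<le> l k" "l j \<le> l k" using that by (auto simp: l_def intro!: le_imp_inverse_le)
      then have "L * l i \<le> L * l k" "L * l j \<le> L * l k" using L by auto
      moreover have "norm (p i - p j) \<le> norm (x - p i) + norm (x - p j)"
        using norm_triangle_ineq4[of "x - p j" "x - p i"] by simp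
      ultimately have "norm (p i - p j) \<le> 2 * L * l k" using px[of i] px[of j] by linarith
      then have "norm (\<xi> i - \<xi> j) \<le> 4 * K * \<omega> (2 * L * l k)"
        using L l by (intro subgradient_modulus[OF m K semi sub sub]) auto
      then show ?thesis using k by simp
    qed
    then show "\<exists>k. \<forall>m\<ge>k. \<forall>n\<ge>k. norm (\<xi> m - \<xi> n) < e" by blast
  qed
  then obtain \<zeta> where \<zeta>: "\<xi> \<longlonglongrightarrow> \<zeta>" by (auto simp: Cauchy_convergent_iff convergent_def)
  have pl: "p \<longlonglongrightarrow> x"
  proof -
    have "(\<lambda>n. L * l n) \<longlonglongrightarrow> L * 0" by (intro tendsto_intros ll)
    then have "(\<lambda>n. x - p n) \<longlonglongrightarrow> 0"
      using px by (intro Lim_null_comparison[of "\<lambda>n. x - p n" "\<lambda>n. L * l n"] always_eventually) auto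
    from tendsto_diff[OF tendsto_const[of x] this] show ?thesis by simp
  qed
  have "F x + inner \<zeta> (z - x) \<le> F z" for z
  proof -
    have "F x - L * norm (x - p n) + inner (\<xi> n) (z - p n) \<le> F z" for n
      using sub[of n z] lip[of x "p n"] by simp
    moreover have "(\<lambda>n. F x - L * norm (x - p n) + inner (\<xi> n) (z - p n))
        \<longlonglongrightarrow> F x - L * norm (x - x) + inner \<zeta> (z - x)"
      by (intro tendsto_intros pl \<zeta>)
    ultimately have "F x - L * norm (x - x) + inner \<zeta> (z - x) \<le> F z"
      by (intro LIMSEQ_le_const2) auto
    then show ?thesis by simp
  qed
  then show ?thesis by blast
qed

text \<open>Any selection of subgradients is the gradient, since the first order remainder is
  squeezed between 0 and \<open>K * norm h * \<omega> (norm h)\<close>.\<close>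

lemma convex_semiconcave_imp_C1omega:
  fixes F :: "'a::{real_inner, complete_space} \<Rightarrow> real"
  assumes m: "modulus_of_continuity \<omega>" and K: "0 < K"
    and cv: "convex_on UNIV F" and lip: "\<And>x y. F x - F y \<le> L * norm (x - y)" and L: "0 < L"
    and semi: "\<And>x h. F (x + h) + F (x - h) - 2 * F x \<le> K * norm h * \<omega> (norm h)"
  obtains G where "C1omega_fun_grad \<omega> F G" and "\<And>x. norm (G x) \<le> L"
    and "\<And>x z. F x + inner (G x) (z - x) \<le> F z"
proof -
  have K0: "0 \<le> K" using K by simp
  obtain G where G: "\<And>x z. F x + inner (G x) (z - x) \<le> F z"
    using ex_subgradient[OF m K0 cv lip L semi] by metis
  have "(F has_derivative (\<lambda>h. inner (G x) h)) (at x)" for x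
    unfolding has_derivative_at
  proof
    show "bounded_linear (inner (G x))" by (rule bounded_linear_inner_right)
    have "(\<lambda>h::'a. norm h) \<midarrow>0\<rightarrow> 0" using tendsto_norm_zero by fastforce
    then have "(\<lambda>h::'a. \<omega> (norm h)) \<midarrow>0\<rightarrow> 0" by (intro modulus_tendsto_0[OF m]) auto
    then have lim: "(\<lambda>h::'a. K * \<omega> (norm h)) \<midarrow>0\<rightarrow> 0" by (intro tendsto_mult_right_zero)
    have "norm (norm (F (x + h) - F x - inner (G x) h) / norm h) \<le> K * \<omega> (norm h)" if "h \<noteq> 0" for h
    proof -
      have "0 \<le> F (x + h) - F x - inner (G x) h" using G[of x "x + h"] by simp
      moreover have "F (x + h) - F x - inner (G x) h \<le> K * norm h * \<omega> (norm h)"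
        using subgradient_upper_bound[OF G semi, of "x + h" x] by simp
      ultimately show ?thesis using that by (simp add: field_simps)
    qed
    then have "\<forall>\<^sub>F h in at 0. norm (norm (F (x + h) - F x - inner (G x) h) / norm h) \<le> K * \<omega> (norm h)"
      by (auto simp: eventually_at_filter)
    then show "(\<lambda>h. norm (F (x + h) - F x - inner (G x) h) / norm h) \<midarrow>0\<rightarrow> 0"
      using lim by (rule Lim_null_comparison)
  qed
  moreover have "norm (G x - G y) \<le> (4 * K) * \<omega> (norm (x - y))" for x y
  proof (cases "x = y")
    case True
    then show ?thesis using modulus_nonneg[OF m, of 0] K by simp
  next
    case False
    then show ?thesis using subgradient_modulus[OF m K0 semi G G, of "norm (x - y)" x y] by simp
  qed
  ultimately have "C1omega_fun_grad \<omega> F G"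
    using K unfolding C1omega_fun_grad_def is_gradient_def
    by (intro conjI allI exI[of _ "4 * K"]) auto
  then show thesis using that G subgradient_norm_le[OF G lip] L by fastforce
qed

section \<open>Convex envelopes\<close>

lemma convex_on_translate:
  fixes F :: "'a::real_vector \<Rightarrow> real"
  assumes "convex_on UNIV F"
  shows "convex_on UNIV (\<lambda>x. F (x + h))"
proof (rule convex_onI)
  fix t :: real and x y :: 'a assume "0 < t" "t < 1"
  moreover have "(1 - t) *\<^sub>R x + t *\<^sub>R y + h = (1 - t) *\<^sub>R (x + h) + t *\<^sub>R (y + h)"
    by (simp add: algebra_simps)
  ultimately show "F ((1 - t) *\<^sub>R x + t *\<^sub>R y + h) \<le> (1 - t) * F (x + h) + t * F (y + h)"
    using convex_onD[OF assms, of t "x + h" "y + h"] by simp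
qed simp

text \<open>The regularity of \<open>g\<close> passes to its convex envelope because \<open>F (x + h) - L * norm h\<close> and
  \<open>(F (x + h) + F (x - h) - \<sigma> h) / 2\<close> are again convex minorants of \<open>g\<close>.\<close>

lemma ex_convex_envelope:
  fixes g :: "'a::real_normed_vector \<Rightarrow> real"
  assumes lip: "\<And>x y. g x - g y \<le> L * norm (x - y)"
    and semi: "\<And>x h. g (x + h) + g (x - h) - 2 * g x \<le> \<sigma> h"
    and q: "convex_on UNIV q" "\<And>x. q x \<le> g x"
  obtains F where "convex_on UNIV F" and "\<And>x. F x \<le> g x"
    and "\<And>p x. convex_on UNIV p \<Longrightarrow> (\<And>z. p z \<le> g z) \<Longrightarrow> p x \<le> F x"
    and "\<And>x y. F x - F y \<le> L * norm (x - y)"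
    and "\<And>x h. F (x + h) + F (x - h) - 2 * F x \<le> \<sigma> h"
proof -
  define P where "P = {p. convex_on UNIV p \<and> (\<forall>z. p z \<le> g z)}"
  define F where "F x = (SUP p\<in>P. p x)" for x
  have ne: "P \<noteq> {}" using q by (auto simp: P_def)
  have bdd: "bdd_above ((\<lambda>p. p x) ` P)" for x
    by (rule bdd_aboveI2[of _ _ "g x"]) (auto simp: P_def)
  have up: "p x \<le> F x" if "p \<in> P" for p x
    unfolding F_def by (rule cSUP_upper[OF that bdd])
  have least: "F x \<le> c" if "\<And>p. p \<in> P \<Longrightarrow> p x \<le> c" for x c
    unfolding F_def using ne that by (rule cSUP_least)
  have max: "p x \<le> F x" if "convex_on UNIV p" "\<And>z. p z \<le> g z" for p x
    using up[of p x] that by (simp add: P_def)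
  have Fg: "F x \<le> g x" for x by (rule least) (auto simp: P_def)
  have cvF: "convex_on UNIV F"
  proof (rule convex_onI)
    fix t :: real and x y :: 'a assume t: "0 < t" "t < 1"
    show "F ((1 - t) *\<^sub>R x + t *\<^sub>R y) \<le> (1 - t) * F x + t * F y"
    proof (rule least)
      fix p assume p: "p \<in> P"
      then have "p ((1 - t) *\<^sub>R x + t *\<^sub>R y) \<le> (1 - t) * p x + t * p y"
        using convex_onD[of UNIV p t x y] t by (simp add: P_def)
      also have "\<dots> \<le> (1 - t) * F x + t * F y"
        using up[OF p] t by (intro add_mono mult_left_mono) auto
      finally show "p ((1 - t) *\<^sub>R x + t *\<^sub>R y) \<le> (1 - t) * F x + t * F y" .
    qed
  qed simp
  have "F x - F y \<le> L * norm (x - y)" for x y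
  proof -
    have "F (y + (x - y)) + (- L * norm (x - y)) \<le> F y"
    proof (rule max[of "\<lambda>z. F (z + (x - y)) + - L * norm (x - y)" y])
      show "convex_on UNIV (\<lambda>z. F (z + (x - y)) + - L * norm (x - y))"
        by (intro convex_on_add convex_on_translate[OF cvF]) (simp add: convex_on_const)
      show "F (z + (x - y)) + - L * norm (x - y) \<le> g z" for z
        using Fg[of "z + (x - y)"] lip[of "z + (x - y)" z] by simp
    qed
    then show ?thesis by simp
  qed
  moreover have "F (x + h) + F (x - h) - 2 * F x \<le> \<sigma> h" for x h
  proof -
    have "1 / 2 * (F (x + h) + F (x + (- h)) + (- \<sigma> h)) \<le> F x"
    proof (rule max[of "\<lambda>z. 1 / 2 * (F (z + h) + F (z + (- h)) + (- \<sigma> h))" x])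
      show "convex_on UNIV (\<lambda>z. 1 / 2 * (F (z + h) + F (z + (- h)) + (- \<sigma> h)))"
        by (intro convex_on_cmul convex_on_add convex_on_translate[OF cvF]) (simp_all add: convex_on_const)
      show "1 / 2 * (F (z + h) + F (z + (- h)) + (- \<sigma> h)) \<le> g z" for z
        using Fg[of "z + h"] Fg[of "z - h"] semi[of z h] by simp
    qed
    then show ?thesis by simp
  qed
  ultimately show thesis using that cvF Fg max by blast
qed

section \<open>The radial penalty function\<close>

text \<open>\<open>\<phi>\<close> is the integral of \<open>w\<close> from 0. The inequality, for
  \<open>s\<close> and \<open>t\<close> in either order, says that \<open>w s\<close> is a
  subgradient of the convex function \<open>\<phi>\<close> at \<open>s\<close>, which is all that is
  used of it.\<close>

lemma ex_primitive_of_mono: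
  fixes w :: "real \<Rightarrow> real"
  assumes cont: "continuous_on {0..} w" and mono: "\<And>s t. 0 \<le> s \<Longrightarrow> s \<le> t \<Longrightarrow> w s \<le> w t"
  obtains \<phi> where "\<phi> 0 = 0" and "\<And>s t. 0 \<le> s \<Longrightarrow> 0 \<le> t \<Longrightarrow> w s * (t - s) \<le> \<phi> t - \<phi> s"
proof -
  define \<phi> where "\<phi> t = integral {0..t} w" for t
  have int: "w integrable_on {a..b}" if "0 \<le> a" for a b
    using that by (intro integrable_continuous_real continuous_on_subset[OF cont]) auto
  have diff: "\<phi> b - \<phi> a = integral {a..b} w" if "0 \<le> a" "a \<le> b" for a b
    using Henstock_Kurzweil_Integration.integral_combine[of 0 a b w] int that by (simp add: \<phi>_def)
  have "w s * (t - s) \<le> \<phi> t - \<phi> s" if "0 \<le> s" "0 \<le> t" for s t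
  proof (cases "s \<le> t")
    case True
    have "integral {s..t} (\<lambda>_. w s) \<le> integral {s..t} w"
      using True that int mono by (intro integral_le) auto
    then show ?thesis using True that diff[of s t] by (simp add: mult.commute)
  next
    case False
    have "integral {t..s} w \<le> integral {t..s} (\<lambda>_. w s)"
      using False that int mono by (intro integral_le) auto
    then show ?thesis using False that diff[of t s] by (simp add: algebra_simps)
  qed
  then show thesis using that[of \<phi>] by (simp add: \<phi>_def)
qed

text \<open>The change of length contributes one \<open>w (norm (a - b))\<close> and the change of
  direction at most two.\<close>

lemma radial_field_modulus:
  fixes a b :: "'a::real_inner" and w :: "real \<Rightarrow> real"
  assumes nonneg: "\<And>t. 0 \<le> t \<Longrightarrow> 0 \<le> w t" and mono: "\<And>s t. 0 \<le> s \<Longrightarrow> s \<le> t \<Longrightarrow> w s \<le> w t"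
    and scale: "\<And>c t. 0 \<le> c \<Longrightarrow> c \<le> 1 \<Longrightarrow> 0 \<le> t \<Longrightarrow> c * w t \<le> w (c * t)"
  shows "norm (w (norm a) *\<^sub>R (a /\<^sub>R norm a) - w (norm b) *\<^sub>R (b /\<^sub>R norm b)) \<le> 3 * w (norm (a - b))"
proof -
  have main: "norm (w (norm a) *\<^sub>R (a /\<^sub>R norm a) - w (norm b) *\<^sub>R (b /\<^sub>R norm b)) \<le> 3 * w (norm (a - b))"
    if ba: "norm b \<le> norm a" for a b :: 'a
  proof (cases "b = 0")
    case True
    have "norm (w (norm a) *\<^sub>R (a /\<^sub>R norm a)) \<le> w (norm a)"
      using nonneg[of "norm a"] by (cases "a = 0") (auto simp: field_simps)
    then show ?thesis using True nonneg[of "norm a"] by simp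
  next
    case False
    then have b: "norm b > 0" and a: "norm a > 0" using ba by (auto simp: less_le_trans)
    define r where "r = norm (a - b)"
    have r: "0 \<le> r" "norm a - norm b \<le> r" "norm b \<le> norm a"
      using ba norm_triangle_ineq2[of a b] by (auto simp: r_def)
    have 1: "w (norm a) - w (norm b) \<le> w r"
    proof -
      \<comment> \<open>Subadditivity of \<open>w\<close>, by splitting \<open>norm a\<close> into
        \<open>norm b\<close> and the rest.\<close>
      have "norm b / norm a * w (norm a) \<le> w (norm b)"
        using scale[of "norm b / norm a" "norm a"] a b ba by simp
      moreover have "(norm a - norm b) / norm a * w (norm a) \<le> w (norm a - norm b)"
        using scale[of "(norm a - norm b) / norm a" "norm a"] a b ba by simp
      moreover have "w (norm a - norm b) \<le> w r" using r by (intro mono) auto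
      moreover have "norm b / norm a * w (norm a) + (norm a - norm b) / norm a * w (norm a) = w (norm a)"
        using a by (simp add: field_simps)
      ultimately show ?thesis by linarith
    qed
    define ea eb where "ea = a /\<^sub>R norm a" and "eb = b /\<^sub>R norm b"
    have e: "norm ea = 1" "norm eb = 1" using a b by (auto simp: ea_def eb_def)
    \<comment> \<open>For \<open>r\<close> up to \<open>norm b\<close>, normalisation is Lipschitz
      and \<open>scale\<close> trades \<open>r / norm b\<close> for \<open>w r\<close>; for larger
      \<open>r\<close>, the crude bound 2 on the distance of unit vectors suffices.\<close>
    have 2: "w (norm b) * norm (ea - eb) \<le> 2 * w r"
    proof (cases "r \<le> norm b")
      case True
      have "norm (eb - ea) \<le> 2 * norm (b - a) / norm b"
        unfolding ea_def eb_def using a b by (intro norm_sgn_diff_le) auto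
      then have "w (norm b) * norm (ea - eb) \<le> w (norm b) * (2 * r / norm b)"
        using nonneg[of "norm b"] by (intro mult_left_mono) (auto simp: r_def norm_minus_commute)
      also have "\<dots> = 2 * (r / norm b * w (norm b))" by simp
      also have "r / norm b * w (norm b) \<le> w r"
        using scale[of "r / norm b" "norm b"] True b r by simp
      finally show ?thesis by simp
    next
      case False
      have "norm (ea - eb) \<le> 2" using norm_triangle_ineq4[of ea eb] e by simp
      then have "w (norm b) * norm (ea - eb) \<le> w r * 2"
        using False nonneg mono[of "norm b" r] r by (intro mult_mono) auto
      then show ?thesis by simp
    qed
    have "w (norm a) *\<^sub>R ea - w (norm b) *\<^sub>R eb = (w (norm a) - w (norm b)) *\<^sub>R ea + w (norm b) *\<^sub>R (ea - eb)"
      by (simp add: algebra_simps)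
    also have "norm \<dots> \<le> norm ((w (norm a) - w (norm b)) *\<^sub>R ea) + norm (w (norm b) *\<^sub>R (ea - eb))"
      by (rule norm_triangle_ineq)
    also have "\<dots> = (w (norm a) - w (norm b)) + w (norm b) * norm (ea - eb)"
      using e mono[of "norm b" "norm a"] nonneg[of "norm b"] ba by simp
    finally show ?thesis using 1 2 by (simp add: ea_def eb_def r_def)
  qed
  show ?thesis
  proof (cases "norm b \<le> norm a")
    case True then show ?thesis by (rule main)
  next
    case False
    then show ?thesis using main[of a b] by (simp add: norm_minus_commute)
  qed
qed

text \<open>\<open>\<psi>\<close> is the penalty added to the tangent planes at points of
  \<open>C\<close>. The inequality with \<open>n\<close> is of Young type and meant for
  \<open>n\<close> a distance of two normals; the last two properties provide points well inside the
  body.\<close>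

lemma ex_radial_kernel:
  assumes m: "modulus_of_continuity \<omega>" and \<delta>: "\<delta> > 0"
  obtains \<psi> :: "'a::real_inner \<Rightarrow> real" and s where "\<psi> 0 = 0"
    and "\<And>a b. \<psi> a - \<psi> b \<le> 2 * norm (a - b)"
    and "\<And>v h. \<psi> (v + h) + \<psi> (v - h) - 2 * \<psi> v \<le> 6 / \<delta> * norm h * \<omega> (norm h)"
    and "\<And>n v. 0 \<le> n \<Longrightarrow> n \<le> 2 \<Longrightarrow> n * norm v \<le> \<psi> v + n * modulus_inv \<omega> (\<delta> * n)"
    and "0 < s" and "\<And>v. norm v = s \<Longrightarrow> \<psi> v \<le> s / 2"
proof -
  have \<omega>0: "\<omega> 0 = 0" and cont: "continuous_on {0..} \<omega>"
    using m unfolding modulus_of_continuity_def by auto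
  \<comment> \<open>Here the slope \<open>\<omega> t / \<delta>\<close> reaches 2, the largest
    distance of two unit vectors, so freezing it beyond \<open>T\<close> keeps all slopes
    \<open>n \<le> 2\<close> available.\<close>
  define T where "T = modulus_inv \<omega> (\<delta> * 2)"
  have T: "0 \<le> T" "\<omega> T = 2 * \<delta>" using modulus_inv_works[OF m, of "\<delta> * 2"] \<delta> by (auto simp: T_def)
  define w where "w t = \<omega> (min t T)" for t
  have w_nonneg: "0 \<le> w t" if "0 \<le> t" for t using modulus_nonneg[OF m] T that by (simp add: w_def)
  have w_mono: "w s \<le> w t" if "0 \<le> s" "s \<le> t" for s t
    unfolding w_def using T that by (intro modulus_mono[OF m]) auto
  have w_scale: "c * w t \<le> w (c * t)" if "0 \<le> c" "c \<le> 1" "0 \<le> t" for c t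
  proof -
    have "c * w t \<le> \<omega> (c * min t T)" unfolding w_def using that T by (intro modulus_scale[OF m]) auto
    also have "\<dots> \<le> w (c * t)"
      unfolding w_def using that T
      by (intro modulus_mono[OF m]) (auto simp: mult_left_le_one_le mult_left_mono intro!: min.coboundedI2
          intro: order_trans[OF mult_left_le_one_le[of "min t T" c]])
    finally show ?thesis .
  qed
  have w_le: "w t \<le> 2 * \<delta>" if "0 \<le> t" for t
    using modulus_mono[OF m, of "min t T" T] T that by (simp add: w_def)
  have w_\<omega>: "w t \<le> \<omega> t" if "0 \<le> t" for t
    unfolding w_def using that T by (intro modulus_mono[OF m]) auto
  have w_cont: "continuous_on {0..} w"
    unfolding w_def by (rule continuous_on_compose2[OF cont]) (use T in \<open>auto intro!: continuous_intros\<close>)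
  obtain \<phi> where \<phi>0: "\<phi> 0 = 0"
    and \<phi>: "\<And>s t. 0 \<le> s \<Longrightarrow> 0 \<le> t \<Longrightarrow> w s * (t - s) \<le> \<phi> t - \<phi> s"
    using ex_primitive_of_mono[OF w_cont w_mono] by blast
  have w0: "w 0 = 0" using T \<omega>0 by (simp add: w_def)
  have \<phi>_nonneg: "0 \<le> \<phi> t" if "0 \<le> t" for t using \<phi>[of 0 t] that w0 \<phi>0 by simp
  define \<psi> :: "'a \<Rightarrow> real" where "\<psi> v = \<phi> (norm v) / \<delta>" for v
  have lip: "\<psi> a - \<psi> b \<le> 2 * norm (a - b)" for a b
  proof -
    have "\<phi> (norm a) - \<phi> (norm b) \<le> w (norm a) * (norm a - norm b)"
      using \<phi>[of "norm a" "norm b"] by (simp add: algebra_simps)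
    also have "\<dots> \<le> w (norm a) * norm (a - b)"
      using w_nonneg norm_triangle_ineq2 by (intro mult_left_mono) auto
    also have "\<dots> \<le> 2 * \<delta> * norm (a - b)" using w_le by (intro mult_right_mono) auto
    finally show ?thesis using \<delta> by (simp add: \<psi>_def field_simps)
  qed
  define D :: "'a \<Rightarrow> 'a" where "D v = w (norm v) *\<^sub>R (v /\<^sub>R norm v)" for v
  have sub: "inner (D b) (a - b) \<le> \<phi> (norm a) - \<phi> (norm b)" for a b
  proof (cases "b = 0")
    case True
    then show ?thesis using \<phi>0 \<phi>_nonneg by (simp add: D_def)
  next
    case False
    have "inner (b /\<^sub>R norm b) a \<le> norm a"
      using norm_cauchy_schwarz[of "b /\<^sub>R norm b" a] False by simp
    moreover have "inner (b /\<^sub>R norm b) b = norm b"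
      using False by (simp add: dot_square_norm power2_eq_square)
    ultimately have "inner (b /\<^sub>R norm b) (a - b) \<le> norm a - norm b"
      by (simp add: inner_diff_right)
    then have "inner (D b) (a - b) \<le> w (norm b) * (norm a - norm b)"
      unfolding D_def inner_scaleR_left[of "w (norm b)"] using w_nonneg by (intro mult_left_mono) auto
    then show ?thesis using \<phi>[of "norm b" "norm a"] by simp
  qed
  \<comment> \<open>The subgradients \<open>D\<close> at \<open>v + h\<close> and
    \<open>v - h\<close>, tested at \<open>v\<close>, bound the second difference by the increment
    of \<open>D\<close> over \<open>2 *\<^sub>R h\<close>. The 6 is the 3 of
    \<open>radial_field_modulus\<close> times 2 from doubling.\<close>
  have semi: "\<psi> (v + h) + \<psi> (v - h) - 2 * \<psi> v \<le> 6 / \<delta> * norm h * \<omega> (norm h)" for v h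
  proof -
    have "\<phi> (norm (v + h)) + \<phi> (norm (v - h)) - 2 * \<phi> (norm v) \<le> inner (D (v + h) - D (v - h)) h"
      using sub[of "v + h" v] sub[of "v - h" v] by (simp add: inner_diff_left)
    also have "\<dots> \<le> norm (D (v + h) - D (v - h)) * norm h" by (rule norm_cauchy_schwarz)
    also have "\<dots> \<le> (3 * w (norm ((v + h) - (v - h)))) * norm h"
      unfolding D_def using w_nonneg w_mono w_scale
      by (intro mult_right_mono radial_field_modulus) auto
    also have "(v + h) - (v - h) = 2 *\<^sub>R h" by (simp add: scaleR_2)
    also have "3 * w (norm (2 *\<^sub>R h)) * norm h \<le> 3 * (2 * \<omega> (norm h)) * norm h"
      using w_\<omega>[of "2 * norm h"] modulus_double[OF m, of "norm h"]
      by (intro mult_right_mono mult_left_mono) auto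
    finally have "(\<phi> (norm (v + h)) + \<phi> (norm (v - h)) - 2 * \<phi> (norm v)) / \<delta> \<le> (3 * (2 * \<omega> (norm h)) * norm h) / \<delta>"
      using \<delta> by (intro divide_right_mono) auto
    then show ?thesis by (simp add: \<psi>_def add_divide_distrib diff_divide_distrib mult_ac)
  qed
  \<comment> \<open>At radius \<open>modulus_inv \<omega> (\<delta> * n)\<close> the slope of
    \<open>\<psi>\<close> is exactly \<open>n\<close>, and the supporting line there gives the
    bound.\<close>
  have gap: "n * norm v \<le> \<psi> v + n * modulus_inv \<omega> (\<delta> * n)" if n: "0 \<le> n" "n \<le> 2" for n v
  proof -
    define s where "s = modulus_inv \<omega> (\<delta> * n)"
    have s: "0 \<le> s" "\<omega> s = \<delta> * n" using modulus_inv_works[OF m, of "\<delta> * n"] n \<delta> by (auto simp: s_def)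
    have "s \<le> T" unfolding s_def T_def using n \<delta> by (intro modulus_inv_mono[OF m]) auto
    then have ws: "w s = \<delta> * n" using s by (simp add: w_def)
    show ?thesis
      using \<phi>[of s "norm v"] s ws \<delta> \<phi>_nonneg[of s] by (simp add: \<psi>_def s_def[symmetric] field_simps)
  qed
  \<comment> \<open>Up to this radius the slope of \<open>\<psi>\<close> is at most
    \<open>1/2\<close>.\<close>
  define s where "s = modulus_inv \<omega> (\<delta> / 2)"
  have s: "0 \<le> s" "\<omega> s = \<delta> / 2" using modulus_inv_works[OF m, of "\<delta> / 2"] \<delta> by (auto simp: s_def)
  have s0: "0 < s" using s \<delta> \<omega>0 by (cases "s = 0") auto
  have dip: "\<psi> v \<le> s / 2" if "norm v = s" for v
  proof -
    have "\<phi> s \<le> w s * s" using \<phi>[of s 0] s \<phi>0 by simp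
    also have "\<dots> \<le> \<delta> / 2 * s" using w_\<omega>[of s] s by (intro mult_right_mono) auto
    finally show ?thesis using \<delta> that by (simp add: \<psi>_def field_simps)
  qed
  have "\<psi> 0 = 0" by (simp add: \<psi>_def \<phi>0)
  then show thesis using that lip semi gap s0 dip by blast
qed

section \<open>Construction of the body from the normals\<close>

lemma condition_imp_body:
  fixes C :: "'a::{real_inner, complete_space} set"
  assumes m: "modulus_of_continuity \<omega>" and ne: "C \<noteq> {}"
    and N: "\<And>x. x \<in> C \<Longrightarrow> norm (N x) = 1" and \<delta>: "\<delta> > 0"
    and cond: "\<And>x y. x \<in> C \<Longrightarrow> y \<in> C \<Longrightarrow>
      norm (N x - N y) * modulus_inv \<omega> (\<delta> * norm (N x - N y)) \<le> inner (N y) (y - x)"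
  shows "\<exists>V. C1omega_convex_body \<omega> V \<and> (bounded C \<longrightarrow> bounded V) \<and> C \<subseteq> frontier V \<and>
           (\<forall>x\<in>C. outer_unit_normal V x (N x))"
proof -
  obtain \<psi> :: "'a \<Rightarrow> real" and s where \<psi>0: "\<psi> 0 = 0"
    and \<psi>_lip: "\<And>a b. \<psi> a - \<psi> b \<le> 2 * norm (a - b)"
    and \<psi>_semi: "\<And>v h. \<psi> (v + h) + \<psi> (v - h) - 2 * \<psi> v \<le> 6 / \<delta> * norm h * \<omega> (norm h)"
    and \<psi>_gap: "\<And>n v. 0 \<le> n \<Longrightarrow> n \<le> 2 \<Longrightarrow> n * norm v \<le> \<psi> v + n * modulus_inv \<omega> (\<delta> * n)"
    and s: "0 < s" and \<psi>_dip: "\<And>v. norm v = s \<Longrightarrow> \<psi> v \<le> s / 2"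
    using ex_radial_kernel[OF m \<delta>] by metis
  \<comment> \<open>The loss term of \<open>\<psi>_gap\<close> for \<open>n = 2\<close>:
    \<open>\<psi>\<close> grows with slope 2 up to the constant \<open>R\<close>.\<close>
  define R where "R = 2 * modulus_inv \<omega> (\<delta> * 2)"
  have R: "0 \<le> R" using modulus_inv_works(1)[OF m, of "\<delta> * 2"] \<delta> by (simp add: R_def)
  have \<psi>_grow: "2 * norm v - R \<le> \<psi> v" for v using \<psi>_gap[of 2 v] by (simp add: R_def)
  define k where "k y z = 1 + inner (N y) (z - y) + \<psi> (z - y)" for y z
  have N_le: "\<bar>inner (N y) v\<bar> \<le> norm v" if "y \<in> C" for y v
    using Cauchy_Schwarz_ineq2[of "N y" v] N[OF that] by simp
  \<comment> \<open>This is where \<open>cond\<close> enters: the Young type bound for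
    \<open>n = norm (N x - N y)\<close> leaves a loss that \<open>cond\<close>, with
    \<open>x\<close> and \<open>y\<close> exchanged, pays for.\<close>
  have k_tangent: "1 + inner (N x) (z - x) \<le> k y z" if x: "x \<in> C" and y: "y \<in> C" for x y z
  proof -
    have n2: "norm (N x - N y) \<le> 2" using norm_triangle_ineq4[of "N x" "N y"] N x y by simp
    have "inner (N x - N y) (z - y) \<le> norm (N x - N y) * norm (z - y)" by (rule norm_cauchy_schwarz)
    also have "\<dots> \<le> \<psi> (z - y) + norm (N x - N y) * modulus_inv \<omega> (\<delta> * norm (N x - N y))"
      using n2 by (intro \<psi>_gap) auto
    also have "norm (N x - N y) * modulus_inv \<omega> (\<delta> * norm (N x - N y)) \<le> inner (N x) (x - y)"
      using cond[OF y x] by (simp add: norm_minus_commute)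
    finally show ?thesis by (simp add: k_def inner_diff_left inner_diff_right)
  qed
  \<comment> \<open>Slope 1 from \<open>N y\<close> plus 2 from \<open>\<psi>\<close>.\<close>
  have k_lip: "k y a - k y b \<le> 3 * norm (a - b)" if "y \<in> C" for y a b
    using N_le[OF that, of "a - b"] \<psi>_lip[of "a - y" "b - y"] by (simp add: k_def inner_diff_right)
  have k_semi: "k y (z + h) + k y (z - h) - 2 * k y z \<le> 6 / \<delta> * norm h * \<omega> (norm h)" for y z h
  proof -
    have "(z - y) + h = z + h - y" "(z - y) - h = z - h - y" by simp_all
    then have "\<psi> (z + h - y) + \<psi> (z - h - y) - 2 * \<psi> (z - y) \<le> 6 / \<delta> * norm h * \<omega> (norm h)"
      using \<psi>_semi[of "z - y" h] by metis
    then show ?thesis by (simp add: k_def inner_diff_right inner_add_right)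
  qed
  have k_grow: "1 + norm (z - y) - R \<le> k y z" if "y \<in> C" for y z
    using N_le[OF that, of "z - y"] \<psi>_grow[of "z - y"] by (simp add: k_def)
  define g where "g z = (INF y\<in>C. k y z)" for z
  obtain x0 where x0: "x0 \<in> C" using ne by blast
  have bdd: "bdd_below ((\<lambda>y. k y z) ` C)" for z
    using k_tangent[OF x0] by (intro bdd_belowI2[of _ "1 + inner (N x0) (z - x0)"])
  have g_le: "g z \<le> k y z" if "y \<in> C" for y z unfolding g_def by (rule cINF_lower[OF bdd that])
  have g_ge: "c \<le> g z" if "\<And>y. y \<in> C \<Longrightarrow> c \<le> k y z" for c z
    unfolding g_def by (rule cINF_greatest[OF ne that])
  have g_lip: "g a - g b \<le> 3 * norm (a - b)" for a b
  proof -
    have "g a - 3 * norm (a - b) \<le> g b"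
      using g_le[of _ a] k_lip[of _ a b] by (intro g_ge) fastforce
    then show ?thesis by simp
  qed
  \<comment> \<open>Upper bounds on second differences survive infima: both outer values are bounded
    through the same \<open>k y\<close>, and then the infimum is taken at the centre.\<close>
  have g_semi: "g (z + h) + g (z - h) - 2 * g z \<le> 6 / \<delta> * norm h * \<omega> (norm h)" for z h
  proof -
    have "(g (z + h) + g (z - h) - 6 / \<delta> * norm h * \<omega> (norm h)) / 2 \<le> g z"
    proof (rule g_ge)
      fix y assume "y \<in> C"
      then show "(g (z + h) + g (z - h) - 6 / \<delta> * norm h * \<omega> (norm h)) / 2 \<le> k y z"
        using g_le[of y "z + h"] g_le[of y "z - h"] k_semi[of y z h] by (simp del: times_divide_eq_left)
    qed
    then show ?thesis by simp
  qed
  have affine: "convex_on UNIV (\<lambda>z. c + b * inner v (z - u))" for c b :: real and v u :: 'a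
    by (rule convex_onI) (auto simp: algebra_simps inner_simps)
  obtain F where cvF: "convex_on UNIV F" and F_le: "\<And>z. F z \<le> g z"
    and F_max: "\<And>p z. convex_on UNIV p \<Longrightarrow> (\<And>z. p z \<le> g z) \<Longrightarrow> p z \<le> F z"
    and F_lip: "\<And>x y. F x - F y \<le> 3 * norm (x - y)"
    and F_semi: "\<And>x h. F (x + h) + F (x - h) - 2 * F x \<le> 6 / \<delta> * norm h * \<omega> (norm h)"
    using ex_convex_envelope[OF g_lip g_semi affine[of 1 1 "N x0" x0]] g_ge k_tangent[OF x0] by auto
  have F_k: "F z \<le> k y z" if "y \<in> C" for y z using F_le g_le[OF that] by (rule order_trans)
  obtain G where G: "C1omega_fun_grad \<omega> F G" and G_le: "\<And>x. norm (G x) \<le> 3"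
    and tangent: "\<And>x z. F x + inner (G x) (z - x) \<le> F z"
    using convex_semiconcave_imp_C1omega[OF m _ cvF F_lip _ F_semi] \<delta> by auto
  have F_N: "1 + inner (N x) (z - x) \<le> F z" if "x \<in> C" for x z
    using F_max[OF affine[of 1 1 "N x" x]] g_ge k_tangent[OF that] by simp
  have FC: "F x = 1" if "x \<in> C" for x
    using F_N[OF that, of x] F_k[OF that, of x] by (simp add: k_def \<psi>0)
  \<comment> \<open>Chosen so that \<open>B * s / 4\<close> equals \<open>R + 1\<close>, which
    lowers the affine function of value 2 at \<open>x\<close> below the growth bound
    \<open>k_grow\<close>; \<open>\<eta>\<close> then keeps its slope at most 1.\<close>
  define B where "B = 4 * (R + 1) / s"
  have B: "0 < B" using R s by (simp add: B_def)
  define \<eta> where "\<eta> = min (1/4) (1 / B)"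
  have \<eta>: "0 < \<eta>" using B by (simp add: \<eta>_def)
  \<comment> \<open>If \<open>G x\<close> were small, then \<open>2 + B * inner (G x) (z - x)\<close> would be a convex minorant of \<open>g\<close>.\<close>
  have G_ge: "\<eta> \<le> norm (G x)" if x: "F x = 1" for x
  proof (rule ccontr)
    assume "\<not> \<eta> \<le> norm (G x)"
    then have small: "norm (G x) \<le> 1/4" and "norm (G x) \<le> 1 / B"
      by (auto simp: \<eta>_def)
    then have small': "B * norm (G x) \<le> 1" using B by (simp add: field_simps)
    have "2 + B * inner (G x) (z - x) \<le> k y z" if y: "y \<in> C" for y z
    proof -
      \<comment> \<open>Going inward from \<open>y\<close> by \<open>s\<close> gains
        \<open>s\<close> from the linear term and loses at most \<open>s / 2\<close> to
        \<open>\<psi>\<close>. The tangent plane at \<open>x\<close> then bounds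
        \<open>inner (G x) (y - x)\<close> away from 0.\<close>
      have "F (y - s *\<^sub>R N y) \<le> 1 - s / 2"
        using F_k[OF y, of "y - s *\<^sub>R N y"] \<psi>_dip[of "- (s *\<^sub>R N y)"] N[OF y] s
        by (simp add: k_def dot_square_norm)
      then have "inner (G x) (y - x) - s * inner (G x) (N y) \<le> - s / 2"
        using tangent[of x "y - s *\<^sub>R N y"] x by (simp add: inner_diff_right)
      moreover have "s * inner (G x) (N y) \<le> s * (1/4)"
        using norm_cauchy_schwarz[of "G x" "N y"] N[OF y] small s by (intro mult_left_mono) auto
      ultimately have "inner (G x) (y - x) \<le> - s / 4" by linarith
      then have "B * inner (G x) (y - x) \<le> B * (- s / 4)" using B by (intro mult_left_mono) auto
      also have "\<dots> = - (R + 1)" using s by (simp add: B_def field_simps)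
      finally have "B * inner (G x) (y - x) \<le> - (R + 1)" .
      moreover have "B * inner (G x) (z - y) \<le> B * (norm (G x) * norm (z - y))"
        using B norm_cauchy_schwarz by (intro mult_left_mono) auto
      moreover have "B * norm (G x) * norm (z - y) \<le> 1 * norm (z - y)"
        using small' by (intro mult_right_mono) auto
      moreover have "B * inner (G x) (z - x) = B * inner (G x) (z - y) + B * inner (G x) (y - x)"
        by (simp add: inner_diff_right algebra_simps)
      ultimately show ?thesis using k_grow[OF y, of z] by simp
    qed
    then have "2 + B * inner (G x) (x - x) \<le> F x"
      using F_max[OF affine[of 2 B "G x" x]] g_ge by blast
    with x show False by simp
  qed
  define V where "V = {z. F z \<le> 1}"
  have contF: "continuous_on UNIV F"
    using G unfolding C1omega_fun_grad_def is_gradient_def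
    by (intro continuous_at_imp_continuous_on ballI has_derivative_continuous) auto
  have clV: "closed V" unfolding V_def using contF by (intro closed_Collect_le) auto
  have opV: "{z. F z < 1} \<subseteq> interior V"
    using contF by (intro interior_maximal open_Collect_less) (auto simp: V_def)
  have frV: "frontier V = F -` {1}"
  proof
    show "frontier V \<subseteq> F -` {1}"
      using clV opV by (force simp: frontier_def V_def)
    show "F -` {1} \<subseteq> frontier V"
    proof
      fix x assume "x \<in> F -` {1}"
      then have x: "F x = 1" by simp
      have "x \<notin> interior V"
      proof
        assume "x \<in> interior V"
        then obtain e where e: "e > 0" "cball x e \<subseteq> V" by (meson mem_interior_cball)
        have Gx: "norm (G x) > 0" using G_ge[OF x] \<eta> by linarith
        define z where "z = x + (e / norm (G x)) *\<^sub>R G x"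
        have "z \<in> cball x e" using e(1) Gx by (simp add: z_def dist_norm)
        then have "F z \<le> 1" using e by (auto simp: V_def)
        moreover have "inner (G x) (z - x) = e * norm (G x)"
          using Gx by (simp add: z_def dot_square_norm power2_eq_square)
        ultimately have "e * norm (G x) \<le> 0" using tangent[of x z] x by simp
        then show False using e(1) Gx by (simp add: mult_le_0_iff)
      qed
      then show "x \<in> frontier V" using x clV by (simp add: frontier_def V_def)
    qed
  qed
  have cvV: "convex V"
    unfolding convex_alt V_def
  proof clarsimp
    fix x y and u :: real assume "F x \<le> 1" "F y \<le> 1" "0 \<le> u" "u \<le> 1"
    then show "F ((1 - u) *\<^sub>R x + u *\<^sub>R y) \<le> 1"
      using convex_onD[OF cvF, of u x y] convex_bound_le[of "F x" 1 "F y" "1 - u" u] by simp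
  qed
  have "F (x0 - s *\<^sub>R N x0) < 1"
    using F_k[OF x0, of "x0 - s *\<^sub>R N x0"] \<psi>_dip[of "- (s *\<^sub>R N x0)"] N[OF x0] s
    by (simp add: k_def dot_square_norm)
  then have "interior V \<noteq> {}" using opV by auto
  then have "convex_body V" using clV cvV by (simp add: convex_body_def)
  moreover define M where "M = max 3 (1 / \<eta>)"
  have "inverse M \<le> \<eta>"
    using le_imp_inverse_le[of "1 / \<eta>" M] \<eta> by (simp add: M_def)
  then have "\<forall>x\<in>frontier V. inverse M \<le> norm (G x) \<and> norm (G x) \<le> M"
    using G_ge G_le frV by (fastforce simp: M_def intro: order_trans)
  ultimately have "C1omega_convex_body \<omega> V"
    unfolding C1omega_convex_body_def using cvF G frV
    by (intro conjI exI[of _ M] exI[of _ F] exI[of _ G]) (auto simp: M_def)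
  moreover have "bounded V" if bC: "bounded C"
  proof -
    obtain b where b: "\<And>y. y \<in> C \<Longrightarrow> norm y \<le> b" using bC by (auto simp: bounded_iff)
    \<comment> \<open>For bounded \<open>C\<close> the growth of the \<open>k y\<close> is uniform
      in \<open>y\<close>, so this shifted norm is a convex minorant of \<open>g\<close>.\<close>
    have "norm z + (1 - R - b) \<le> F z" for z
    proof (rule F_max[of "\<lambda>z. norm z + (1 - R - b)"])
      show "convex_on UNIV (\<lambda>z::'a. norm z + (1 - R - b))"
        using convex_on_dist[of UNIV "0::'a"]
        by (intro convex_on_add) (simp_all add: convex_on_const)
      show "norm z + (1 - R - b) \<le> g z" for z
      proof (rule g_ge)
        fix y assume "y \<in> C"
        then show "norm z + (1 - R - b) \<le> k y z"
          using b[of y] k_grow[of y z] norm_triangle_ineq2[of z y] by simp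
      qed
    qed
    then have "norm z \<le> R + b" if "z \<in> V" for z
      using that by (smt (verit) V_def mem_Collect_eq)
    then show ?thesis by (auto simp: bounded_iff)
  qed
  moreover have "C \<subseteq> frontier V" using FC frV by auto
  moreover have "outer_unit_normal V x (N x)" if x: "x \<in> C" for x
  proof -
    have "inner (N x) (z - x) \<le> 0" if "z \<in> V" for z
      using F_N[OF x, of z] that by (simp add: V_def)
    then show ?thesis using FC[OF x] frV N[OF x] by (simp add: outer_unit_normal_def)
  qed
  ultimately show ?thesis by blast
qed

text \<open>This covers empty \<open>C\<close>, over which no infimum can be taken. A single
  prescribed normal at the origin reduces it to the nonempty case; the zero space has no unit
  vector, but there the whole space is bounded and has empty frontier.\<close>

lemma ex_bounded_C1omega_convex_body:
  assumes m: "modulus_of_continuity \<omega>"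
  shows "\<exists>V::'a::{real_inner, complete_space} set. C1omega_convex_body \<omega> V \<and> bounded V"
proof (cases "\<exists>v::'a. v \<noteq> 0")
  case True
  then obtain v :: 'a where "v \<noteq> 0" by blast
  then have "norm (v /\<^sub>R norm v) = 1" by simp
  then show ?thesis
    using condition_imp_body[OF m, of "{0}" "\<lambda>_. v /\<^sub>R norm v" 1] by auto
next
  case False
  then have "(UNIV :: 'a set) = {0}" by auto
  then have "bounded (UNIV :: 'a set)" by (metis bounded_insert bounded_empty)
  moreover have "C1omega_convex_body \<omega> (UNIV :: 'a set)"
  proof -
    have "C1omega_fun_grad \<omega> (\<lambda>_::'a. 0) (\<lambda>_. 0)"
      unfolding C1omega_fun_grad_def
    proof
      show "is_gradient (\<lambda>_::'a. 0) (\<lambda>_. 0)" by (simp add: is_gradient_def)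
      show "\<exists>K>0. \<forall>x y::'a. norm (0 - 0 :: 'a) \<le> K * \<omega> (norm (x - y))"
        using modulus_nonneg[OF m] by (intro exI[of _ "1::real"]) simp
    qed
    moreover have "convex_on UNIV (\<lambda>_::'a. 0)" by (simp add: convex_on_const)
    ultimately have "\<exists>F G. convex_on UNIV F \<and> C1omega_fun_grad \<omega> F G \<and>
        frontier (UNIV :: 'a set) = F -` {1} \<and>
        (\<forall>x\<in>frontier UNIV. inverse 1 \<le> norm (G x) \<and> norm (G x) \<le> 1)"
      by (intro exI[of _ "\<lambda>_. 0"]) simp
    then show ?thesis
      unfolding C1omega_convex_body_def convex_body_def
      by (intro conjI exI[of _ "1::real"]) simp_all
  qed
  ultimately show ?thesis by blast
qed

theorem theorem3p3:
  fixes \<omega> :: "real \<Rightarrow> real"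
    and C :: "'a::{real_inner, complete_space} set"
    and N :: "'a \<Rightarrow> 'a"
  assumes "modulus_of_continuity \<omega>"
    and "\<forall>x\<in>C. norm (N x) = 1"
  shows "((\<exists>V. C1omega_convex_body \<omega> V \<and> C \<subseteq> frontier V \<and>
             (\<forall>x\<in>C. outer_unit_normal V x (N x)))
         \<longleftrightarrow>
         (\<exists>\<delta>>0. \<forall>x\<in>C. \<forall>y\<in>C.
             inner (N y) (y - x) \<ge>
               norm (N x - N y) * modulus_inv \<omega> (\<delta> * norm (N x - N y))))
         \<and>
         (bounded C \<longrightarrow>
         (\<exists>\<delta>>0. \<forall>x\<in>C. \<forall>y\<in>C.
             inner (N y) (y - x) \<ge>
               norm (N x - N y) * modulus_inv \<omega> (\<delta> * norm (N x - N y))) \<longrightarrow>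
         (\<exists>V. C1omega_convex_body \<omega> V \<and> bounded V \<and> C \<subseteq> frontier V \<and>
             (\<forall>x\<in>C. outer_unit_normal V x (N x))))"
proof -
  have body: "\<exists>V. C1omega_convex_body \<omega> V \<and> (bounded C \<longrightarrow> bounded V) \<and> C \<subseteq> frontier V \<and>
      (\<forall>x\<in>C. outer_unit_normal V x (N x))"
    if "\<exists>\<delta>>0. \<forall>x\<in>C. \<forall>y\<in>C. inner (N y) (y - x) \<ge>
          norm (N x - N y) * modulus_inv \<omega> (\<delta> * norm (N x - N y))"
  proof (cases "C = {}")
    case True
    then show ?thesis using ex_bounded_C1omega_convex_body[OF assms(1)] by auto
  next
    case False
    obtain \<delta> where "\<delta> > 0" "\<And>x y. x \<in> C \<Longrightarrow> y \<in> C \<Longrightarrow>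
        norm (N x - N y) * modulus_inv \<omega> (\<delta> * norm (N x - N y)) \<le> inner (N y) (y - x)"
      using \<open>\<exists>\<delta>>0. _\<close> by blast
    then show ?thesis using condition_imp_body[OF assms(1) False] assms(2) by blast
  qed
  show ?thesis
    using normals_of_body_imp_condition[OF assms(1)] body by blast
qed

end
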